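(* Let $\mathcal{H}_1,\dots,\mathcal{H}_n$ be Hilbert spaces and let $\mathcal{M}=(A_{ij})_{1\le i,j\le n}$ be an operator matrix in $\mathcal{H}=\bigoplus_{j=1}^n\mathcal{H}_j$, where each $A_{ij}$ is an unbounded linear operator from $\mathcal{D}(A_{ij})\subset\mathcal{H}_j$ to $\mathcal{H}_i$. Suppose that $\mathcal{M}$ is diagonally generalized subordinate, and let $(b_k)_{1\le k\le N}\subset\mathbb{R}_+$ and $(p_k)_{1\le k\le N}$ be the finite families of all constants and all exponents occurring in the subordination inequalities (as described in the context); suppose that $p_k\in[0,1)$ for all $k$. Suppose moreover that for each $j=1,\dots,n$ the operator $A_{jj}$ is normal with compact resolvent and that its spectrum lies on finitely many rays: $$\sigma(A_{jj})\subset\bigcup_{l=1}^{m_j}e^{\mathbf{i}\theta_{jl}}\mathbb{R}_{\ge 0},\qquad 0\le\theta_{jl}\le 2\pi,\quad l=1,\dots,m_j .$$ Let $\theta_1,\dots,\theta_m$ ($m\in\mathbb{N}^*$) be an enumeration of the angles $\theta_{jl}$ ($1\le j\le n$, $1\le l\le m_j$). Then $\mathcal{M}$ has compact resolvent, and for every $\alpha>\sum_{k=1}^N b_k$ there exists $r_0>0$ such that $$\sigma(\mathcal{M})\subset B_{r_0}(0)\cup\bigcup_{l=1}^{m}\Big\{e^{\mathbf{i}\theta_l}(x+\mathbf{i}y)\;:\;x\ge 0\ \text{ and }\ |y|\le\max_{1\le k\le N}\alpha x^{p_k}\Big\}.$$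
   Context: $\mathcal{H}=\bigoplus_{j=1}^n\mathcal{H}_j$ is the Hilbert space direct sum. The operator matrix $\mathcal{M}$ has its natural domain $\mathcal{D}(\mathcal{M})=\bigoplus_{j=1}^n\bigcap_{i=1}^n\mathcal{D}(A_{ij})$. Put $\Omega_n=\{(i,j)\in\{1,\dots,n\}^2: i\ne j\}$. $\mathbb{N}^*=\{1,2,\dots\}$, $\mathbf{i}^2=-1$, and $B_{r_0}(0)$ is the disc of radius $r_0$ centred at $0$ in $\mathbb{C}$. $\mathcal{M}$ is called diagonally generalized subordinate if for all $(i,j)\in\Omega_n$ the operator $A_{ij}$ is generalized subordinate to $A_{jj}$, i.e. $\mathcal{D}(A_{jj})\subset\mathcal{D}(A_{ij})$ and there exist $N^{(i,j)}\in\mathbb{N}^*$, exponents $(p_k^{(i,j)})_{k=1}^{N^{(i,j)}}\subset[0,1]$ and constants $(b_k^{(i,j)})_{k=1}^{N^{(i,j)}}\subset\mathbb{R}_+$ such that $$\|A_{ij}U_j\|\le\sum_{k=1}^{N^{(i,j)}}b_k^{(i,j)}\|A_{jj}U_j\|^{p_k^{(i,j)}}\|U_j\|^{1-p_k^{(i,j)}}\qquad\text{for all }U_j\in\mathcal{D}(A_{jj})$$ (with the convention $0^0=1$). Given such constants and exponents, $N=\sum_{(i,j)\in\Omega_n}N^{(i,j)}$, and $(b_k)_{k=1}^N$, $(p_k)_{k=1}^N$ denote the families obtained by concatenating, over all $(i,j)\in\Omega_n$, the families $(b_k^{(i,j)})_{k=1}^{N^{(i,j)}}$ and $(p_k^{(i,j)})_{k=1}^{N^{(i,j)}}$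 respectively (in the same order). *)

theory Defs
  imports "HOL-Analysis.Analysis"
begin

section \<open>Complex Hilbert spaces\<close>

text \<open>
  The norm and topology are those of the underlying real inner product space; \<open>Re_cinner\<close> forces
  them to be the ones induced by \<open>cinner\<close>, which is linear in its first argument.
\<close>

class complex_inner = real_inner +
  fixes scaleC :: "complex \<Rightarrow> 'a \<Rightarrow> 'a" (infixr "*\<^sub>C" 75)
    and cinner :: "'a \<Rightarrow> 'a \<Rightarrow> complex"
  assumes scaleC_add_right: "c *\<^sub>C (x + y) = c *\<^sub>C x + c *\<^sub>C y"
    and scaleC_add_left: "(c + d) *\<^sub>C x = c *\<^sub>C x + d *\<^sub>C x"
    and scaleC_scaleC: "c *\<^sub>C d *\<^sub>C x = (c * d) *\<^sub>C x"
    and scaleC_of_real: "complex_of_real r *\<^sub>C x = r *\<^sub>R x"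
    and cinner_add_left: "cinner (x + y) z = cinner x z + cinner y z"
    and cinner_scaleC_left: "cinner (c *\<^sub>C x) y = c * cinner x y"
    and cinner_commute: "cinner x y = cnj (cinner y x)"
    and Re_cinner: "Re (cinner x y) = x \<bullet> y"

class complex_hilbert = complex_inner + complete_space

global_interpretation complex_vector: vector_space "scaleC :: complex \<Rightarrow> 'a \<Rightarrow> 'a::complex_inner"
proof
  fix x :: 'a
  show "1 *\<^sub>C x = x"
    using scaleC_of_real[of 1 x] by simp
qed (simp_all add: scaleC_add_right scaleC_add_left scaleC_scaleC)

instantiation complex :: complex_hilbert
begin

definition scaleC_complex :: "complex \<Rightarrow> complex \<Rightarrow> complex"
  where "scaleC_complex c x = c * x"

definition cinner_complex :: "complex \<Rightarrow> complex \<Rightarrow> complex"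
  where "cinner_complex x y = x * cnj y"

instance
  by standard
    (simp_all add: scaleC_complex_def cinner_complex_def algebra_simps scaleR_conv_of_real
      inner_complex_def)

end

text \<open>
  On \<open>'a ^ 'n\<close> the library's norm is the \<open>\<ell>\<^sup>2\<close> norm of the component norms, so \<open>'a ^ 'n\<close> is the
  Hilbert space direct sum of copies of \<open>'a\<close>.
\<close>

instantiation vec :: (complex_inner, finite) complex_inner
begin

definition scaleC_vec :: "complex \<Rightarrow> 'a ^ 'b \<Rightarrow> 'a ^ 'b"
  where "scaleC_vec c U = (\<chi> j. c *\<^sub>C (U $ j))"

definition cinner_vec :: "'a ^ 'b \<Rightarrow> 'a ^ 'b \<Rightarrow> complex"
  where "cinner_vec U V = (\<Sum>j\<in>UNIV. cinner (U $ j) (V $ j))"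

instance
proof
  fix c d :: complex and r :: real and x y z :: "'a ^ 'b"
  show "c *\<^sub>C (x + y) = c *\<^sub>C x + c *\<^sub>C y"
    by (simp add: scaleC_vec_def vec_eq_iff scaleC_add_right)
  show "(c + d) *\<^sub>C x = c *\<^sub>C x + d *\<^sub>C x"
    by (simp add: scaleC_vec_def vec_eq_iff scaleC_add_left)
  show "c *\<^sub>C d *\<^sub>C x = (c * d) *\<^sub>C x"
    by (simp add: scaleC_vec_def vec_eq_iff scaleC_scaleC)
  show "complex_of_real r *\<^sub>C x = r *\<^sub>R x"
    by (simp add: scaleC_vec_def vec_eq_iff scaleC_of_real)
  show "cinner (x + y) z = cinner x z + cinner y z"
    by (simp add: cinner_vec_def cinner_add_left sum.distrib)
  show "cinner (c *\<^sub>C x) y = c * cinner x y"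
    by (simp add: cinner_vec_def scaleC_vec_def cinner_scaleC_left sum_distrib_left)
  show "cinner x y = cnj (cinner y x)"
    unfolding cinner_vec_def cnj_sum by (rule sum.cong[OF refl]) (rule cinner_commute)
  show "Re (cinner x y) = x \<bullet> y"
    by (simp add: cinner_vec_def inner_vec_def Re_cinner)
qed

end

instance vec :: (complex_hilbert, finite) complex_hilbert ..

text \<open>
  A family of (possibly different) Hilbert spaces is represented by closed complex subspaces of a
  common Hilbert space \<open>'a\<close>. This is no restriction: any family of Hilbert spaces embeds
  isometrically as closed subspaces of a single one, for instance of its direct sum.
\<close>

definition hilbert_subspace :: "'a::complex_hilbert set \<Rightarrow> bool"
  where "hilbert_subspace H \<longleftrightarrow> complex_vector.subspace H \<and> closed H"

definition hilbert_sum :: "('n::finite \<Rightarrow> 'a::complex_hilbert set) \<Rightarrow> ('a ^ 'n) set"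
  where "hilbert_sum H = {U. \<forall>j. U $ j \<in> H j}"

section \<open>Unbounded operators\<close>

text \<open>
  An unbounded operator is a domain together with a map, whose values outside the domain are
  irrelevant. All notions below that depend on the ambient space take it as an explicit
  argument \<open>H\<close>.
\<close>

datatype ('a, 'b) unbounded_op = Unbounded_Op (domain: "'a set") (app: "'a \<Rightarrow> 'b")

definition linear_op ::
    "'a::complex_inner set \<Rightarrow> 'b::complex_inner set \<Rightarrow> ('a, 'b) unbounded_op \<Rightarrow> bool"
  where "linear_op H K T \<longleftrightarrow>
    complex_vector.subspace (domain T) \<and> domain T \<subseteq> H \<and> app T ` domain T \<subseteq> K \<and>
    (\<forall>x\<in>domain T. \<forall>y\<in>domain T. app T (x + y) = app T x + app T y) \<and>
    (\<forall>c. \<forall>x\<in>domain T. app T (c *\<^sub>C x) = c *\<^sub>C app T x)"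

definition densely_defined :: "'a::complex_inner set \<Rightarrow> ('a, 'b) unbounded_op \<Rightarrow> bool"
  where "densely_defined H T \<longleftrightarrow> H \<subseteq> closure (domain T)"

definition closed_op :: "('a::topological_space, 'b::topological_space) unbounded_op \<Rightarrow> bool"
  where "closed_op T \<longleftrightarrow> closed {(x, app T x) | x. x \<in> domain T}"

definition op_eq :: "('a, 'b) unbounded_op \<Rightarrow> ('a, 'b) unbounded_op \<Rightarrow> bool"
  where "op_eq S T \<longleftrightarrow> domain S = domain T \<and> (\<forall>x\<in>domain S. app S x = app T x)"

definition op_comp ::
    "('b, 'c) unbounded_op \<Rightarrow> ('a, 'b) unbounded_op \<Rightarrow> ('a, 'c) unbounded_op"
  where "op_comp S T = Unbounded_Op {x \<in> domain T. app T x \<in> domain S} (\<lambda>x. app S (app T x))"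

text \<open>The vector \<open>z\<close> below is unique when \<open>T\<close> is densely defined in \<open>H\<close>.\<close>

definition adjoint_op :: "'a::complex_inner set \<Rightarrow> ('a, 'a) unbounded_op \<Rightarrow> ('a, 'a) unbounded_op"
  where "adjoint_op H T = Unbounded_Op
    {y \<in> H. \<exists>z\<in>H. \<forall>x\<in>domain T. cinner (app T x) y = cinner x z}
    (\<lambda>y. THE z. z \<in> H \<and> (\<forall>x\<in>domain T. cinner (app T x) y = cinner x z))"

definition normal_op :: "'a::complex_inner set \<Rightarrow> ('a, 'a) unbounded_op \<Rightarrow> bool"
  where "normal_op H T \<longleftrightarrow>
    densely_defined H T \<and> closed_op T \<and>
    op_eq (op_comp (adjoint_op H T) T) (op_comp T (adjoint_op H T))"

definition resolvent :: "('a::complex_inner, 'a) unbounded_op \<Rightarrow> complex \<Rightarrow> 'a \<Rightarrow> 'a"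
  where "resolvent T z = inv_into (domain T) (\<lambda>x. app T x - z *\<^sub>C x)"

definition resolvent_set :: "'a::complex_inner set \<Rightarrow> ('a, 'a) unbounded_op \<Rightarrow> complex set"
  where "resolvent_set H T =
    {z. bij_betw (\<lambda>x. app T x - z *\<^sub>C x) (domain T) H \<and>
        (\<exists>C. \<forall>y\<in>H. norm (resolvent T z y) \<le> C * norm y)}"

definition spectrum :: "'a::complex_inner set \<Rightarrow> ('a, 'a) unbounded_op \<Rightarrow> complex set"
  where "spectrum H T = - resolvent_set H T"

definition compact_map :: "'a::metric_space set \<Rightarrow> ('a \<Rightarrow> 'b::topological_space) \<Rightarrow> bool"
  where "compact_map H R \<longleftrightarrow> (\<forall>B\<subseteq>H. bounded B \<longrightarrow> compact (closure (R ` B)))"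

text \<open>
  By the resolvent identity it does not matter for which point of the resolvent set the resolvent
  is required to be compact.
\<close>

definition has_compact_resolvent :: "'a::complex_inner set \<Rightarrow> ('a, 'a) unbounded_op \<Rightarrow> bool"
  where "has_compact_resolvent H T \<longleftrightarrow> (\<exists>z\<in>resolvent_set H T. compact_map H (resolvent T z))"

section \<open>Operator matrices and generalized subordination\<close>

definition op_matrix :: "('n::finite \<Rightarrow> 'n \<Rightarrow> ('a::complex_inner, 'a) unbounded_op) \<Rightarrow>
    ('a ^ 'n, 'a ^ 'n) unbounded_op"
  where "op_matrix A = Unbounded_Op
    {U. \<forall>j. U $ j \<in> (\<Inter>i. domain (A i j))}
    (\<lambda>U. \<chi> i. \<Sum>j\<in>UNIV. app (A i j) (U $ j))"

text \<open>Real powers of nonnegative reals with \<open>0\<^sup>0 = 1\<close>, whereas the library has \<open>0 powr 0 = 0\<close>.\<close>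

definition rpow :: "real \<Rightarrow> real \<Rightarrow> real"
  where "rpow x p = (if p = 0 then 1 else x powr p)"

definition subordination_data :: "('a::real_normed_vector, 'b::real_normed_vector) unbounded_op \<Rightarrow>
    ('a, 'c::real_normed_vector) unbounded_op \<Rightarrow>
    nat \<Rightarrow> (nat \<Rightarrow> real) \<Rightarrow> (nat \<Rightarrow> real) \<Rightarrow> bool"
  where "subordination_data S T N b p \<longleftrightarrow>
    1 \<le> N \<and> (\<forall>k\<in>{1..N}. 0 \<le> p k \<and> p k \<le> 1) \<and> (\<forall>k\<in>{1..N}. 0 \<le> b k) \<and>
    (\<forall>x\<in>domain T. norm (app S x) \<le>
       (\<Sum>k=1..N. b k * rpow (norm (app T x)) (p k) * rpow (norm x) (1 - p k)))"

definition generalized_subordinate ::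
    "('a::real_normed_vector, 'b::real_normed_vector) unbounded_op \<Rightarrow>
    ('a, 'c::real_normed_vector) unbounded_op \<Rightarrow> bool"
  where "generalized_subordinate S T \<longleftrightarrow>
    domain T \<subseteq> domain S \<and> (\<exists>N b p. subordination_data S T N b p)"

definition diagonally_generalized_subordinate ::
    "('n \<Rightarrow> 'n \<Rightarrow> ('a::real_normed_vector, 'a) unbounded_op) \<Rightarrow> bool"
  where "diagonally_generalized_subordinate A \<longleftrightarrow>
    (\<forall>i j. i \<noteq> j \<longrightarrow> generalized_subordinate (A i j) (A j j))"

text \<open>
  The index set of the families obtained by concatenating, over all pairs \<open>i \<noteq> j\<close>, families
  indexed by \<open>1, \<dots>, N i j\<close>; it has \<open>\<Sum>\<^bsub>i \<noteq> j\<^esub> N i j\<close> elements.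
\<close>

definition concat_index :: "('n \<Rightarrow> 'n \<Rightarrow> nat) \<Rightarrow> ('n \<times> 'n \<times> nat) set"
  where "concat_index N = {(i, j, k). i \<noteq> j \<and> k \<in> {1..N i j}}"

definition ray :: "real \<Rightarrow> complex set"
  where "ray \<theta> = {cis \<theta> * complex_of_real x | x. 0 \<le> x}"

text \<open>
  The set of all \<open>e\<^sup>i\<^sup>\<theta> (x + iy)\<close> with \<open>x \<ge> 0\<close> and \<open>\<bar>y\<bar>\<close> at most the maximum of \<open>\<alpha> x\<^sup>q\<close> over \<open>q \<in> P\<close>.
  As \<open>\<alpha> x\<^sup>q \<ge> 0\<close> for \<open>\<alpha> \<ge> 0\<close>, inserting \<open>0\<close> only fixes the maximum of the empty family,
  which arises for a one-by-one matrix.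
\<close>

definition power_region :: "real \<Rightarrow> real set \<Rightarrow> real \<Rightarrow> complex set"
  where "power_region \<alpha> P \<theta> =
    {cis \<theta> * Complex x y | x y. 0 \<le> x \<and> \<bar>y\<bar> \<le> Max (insert 0 ((\<lambda>q. \<alpha> * rpow x q) ` P))}"

end

theory Submission
  imports Defs "HOL-Complex_Analysis.Complex_Analysis"
begin

text \<open>
  Let \<open>D\<close> be the diagonal and \<open>B\<close> the off-diagonal part of the operator matrix \<open>M\<close>. Off the spectrum of
  \<open>D\<close> one has \<open>M - z = (1 + B K) (D - z)\<close> with \<open>K = (D - z)\<^sup>-\<^sup>1\<close>, so \<open>z\<close> is in the resolvent set of \<open>M\<close>, with
  compact resolvent, as soon as \<open>\<parallel>B K\<parallel> < 1\<close> (\<open>op_matrix_resolvent\<close>).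

  For a normal operator \<open>T\<close> and a point \<open>z\<close> at distance at least \<open>d > 0\<close> from a cone \<open>S\<close> that contains the
  spectrum, \<open>\<parallel>(T - z)\<^sup>-\<^sup>1\<parallel> \<le> 1 / d\<close> and \<open>\<parallel>T (T - z)\<^sup>-\<^sup>1\<parallel> \<le> \<bar>z\<bar> / d\<close> (\<open>normal_op_cone_bounds\<close>). A subordination
  term \<open>b \<parallel>T x\<parallel>\<^sup>q \<parallel>x\<parallel>\<^bsup>1 - q\<^esup>\<close> thus contributes at most \<open>b \<bar>z\<bar>\<^sup>q / d\<close> to \<open>\<parallel>B K\<parallel>\<close>. Hence \<open>z\<close> is in the resolvent
  set of \<open>M\<close> if \<open>\<beta> \<bar>z\<bar>\<^sup>q \<le> d\<close> for all exponents \<open>q\<close>, where \<open>\<beta>\<close> is any number exceeding the sum of all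
  constants \<open>b\<close> (\<open>op_matrix_resolvent_outside_cone\<close>). With \<open>S\<close> the union of the rays, this holds for all
  large \<open>z\<close> outside the parabola-like regions (\<open>dist_ray_outside_power_region\<close>), and for some \<open>z\<close>, namely far
  out in a direction that avoids the rays; the latter gives compactness of the resolvent.

  The first resolvent bound is usually read off from the spectral theorem, but it has a more elementary
  proof. By von Neumann's theorem on \<open>1 + T\<^sup>* T\<close>, the domain of \<open>T\<^sup>* T\<close> is a core of \<open>T\<close>, whence
  \<open>\<parallel>T\<^sup>* x\<parallel> = \<parallel>T x\<parallel>\<close> on the domain of \<open>T\<close> (\<open>normal_op_adjoint\<close>). So the resolvent \<open>R = (T - z)\<^sup>-\<^sup>1\<close> satisfies
  \<open>\<parallel>R y\<parallel>\<^sup>2 \<le> \<parallel>R\<^sup>2 y\<parallel> \<parallel>y\<parallel>\<close>, which makes the sequence \<open>\<parallel>R\<^sup>n y\<parallel>\<close> logarithmically convex. Cauchy's inequality for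
  the analytic resolvent bounds \<open>\<parallel>R\<^sup>n y\<parallel> r\<^sup>n\<close> for every \<open>r\<close> below the distance from \<open>z\<close> to the spectrum, and
  log-convexity turns this into \<open>r \<parallel>R y\<parallel> \<le> \<parallel>y\<parallel>\<close> (\<open>normal_op_norm_lower_bound\<close>). The second bound follows by
  applying the first at the points \<open>s z\<close>, \<open>s > 0\<close>.
\<close>

section \<open>Complex inner products\<close>

lemma cinner_add_right: "cinner x (y + z) = cinner x y + cinner x z"
  by (metis cinner_add_left cinner_commute complex_cnj_add)

lemma cinner_scaleC_right: "cinner x (c *\<^sub>C y) = cnj c * cinner x y"
  by (metis cinner_scaleC_left cinner_commute complex_cnj_mult)

lemma cinner_diff_left: "cinner (x - y) z = cinner x z - cinner y z"
  by (metis add_diff_cancel cinner_add_left diff_add_cancel)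

lemma cinner_diff_right: "cinner x (y - z) = cinner x y - cinner x z"
  by (metis add_diff_cancel cinner_add_right diff_add_cancel)

lemma cinner_self: "cinner x x = complex_of_real ((norm x)\<^sup>2)"
proof (rule complex_eqI)
  show "Re (cinner x x) = Re (complex_of_real ((norm x)\<^sup>2))"
    by (simp add: Re_cinner power2_norm_eq_inner)
  show "Im (cinner x x) = Im (complex_of_real ((norm x)\<^sup>2))"
    using cinner_commute[of x x] by (simp add: complex_eq_iff)
qed

lemma norm_scaleC: "norm (c *\<^sub>C x) = norm c * norm x"
proof -
  have "complex_of_real ((norm (c *\<^sub>C x))\<^sup>2) = c * cnj c * complex_of_real ((norm x)\<^sup>2)"
    unfolding cinner_self[symmetric] by (simp only: cinner_scaleC_left cinner_scaleC_right mult.assoc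
      mult.left_commute)
  also have "\<dots> = complex_of_real ((norm c * norm x)\<^sup>2)"
    by (simp add: complex_norm_square[symmetric] power_mult_distrib)
  finally have "(norm (c *\<^sub>C x))\<^sup>2 = (norm c * norm x)\<^sup>2"
    using of_real_eq_iff by blast
  then show ?thesis
    by (simp add: power2_eq_iff_nonneg)
qed

lemma cinner_Cauchy_Schwarz: "norm (cinner x y) \<le> norm x * norm y"
proof (cases "cinner x y = 0")
  case False
  \<comment> \<open>Rotating \<open>x\<close> makes the inner product real, so that the real inequality applies.\<close>
  define c where "c = cnj (sgn (cinner x y))"
  have c: "norm c = 1"
    using False by (simp add: c_def norm_sgn)
  have "c * cinner x y = complex_of_real (norm (cinner x y))"
    using False
    by (simp add: c_def sgn_eq field_simps complex_norm_square[symmetric] power2_eq_square)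
  then have "norm (cinner x y) = Re (cinner (c *\<^sub>C x) y)"
    by (simp add: cinner_scaleC_left)
  also have "\<dots> \<le> norm (c *\<^sub>C x) * norm y"
    by (simp add: Re_cinner norm_cauchy_schwarz)
  finally show ?thesis
    by (simp add: norm_scaleC c)
qed simp

lemma cinner_scaleR_left:
  fixes x :: "'a::complex_inner"
  shows "cinner (r *\<^sub>R x) y = r *\<^sub>R cinner x y"
  by (simp only: scaleC_of_real[symmetric, where 'a = 'a] cinner_scaleC_left scaleR_conv_of_real)

lemma cinner_scaleR_right:
  fixes y :: "'a::complex_inner"
  shows "cinner x (r *\<^sub>R y) = r *\<^sub>R cinner x y"
  by (simp only: scaleC_of_real[symmetric, where 'a = 'a] cinner_scaleC_right
      scaleR_conv_of_real complex_cnj_complex_of_real)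

lemma bounded_linear_cinner_left: "bounded_linear (\<lambda>x. cinner x y)"
  by (rule bounded_linear_intro[where K = "norm y"])
    (simp_all add: cinner_add_left cinner_scaleR_left cinner_Cauchy_Schwarz)

lemma bounded_linear_cinner_right: "bounded_linear (\<lambda>y. cinner x y)"
  by (rule bounded_linear_intro[where K = "norm x"])
    (simp_all add: cinner_add_right cinner_scaleR_right order_trans[OF cinner_Cauchy_Schwarz])

lemmas tendsto_cinner_left = bounded_linear.tendsto[OF bounded_linear_cinner_left]
lemmas tendsto_cinner_right = bounded_linear.tendsto[OF bounded_linear_cinner_right]

text \<open>Orthogonality to a complex subspace can be tested with the real inner product.\<close>

lemma cinner_eq_if_inner_eq:
  assumes "x \<in> S" and "complex_vector.subspace S"
    and eq: "\<And>u. u \<in> S \<Longrightarrow> f u \<bullet> y = u \<bullet> z" and f: "\<And>c. f (c *\<^sub>C x) = c *\<^sub>C f x"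
  shows "cinner (f x) y = cinner x z"
proof (rule complex_eqI)
  show "Re (cinner (f x) y) = Re (cinner x z)"
    using eq[OF assms(1)] by (simp add: Re_cinner)
  have "\<i> *\<^sub>C x \<in> S"
    using assms(1,2) complex_vector.subspace_scale by blast
  then have "Re (cinner (f (\<i> *\<^sub>C x)) y) = Re (cinner (\<i> *\<^sub>C x) z)"
    using eq by (simp add: Re_cinner)
  then show "Im (cinner (f x) y) = Im (cinner x z)"
    by (simp add: f cinner_scaleC_left)
qed

section \<open>Orthogonal projection\<close>

lemma power2_norm_diff_scaleR:
  fixes v u :: "'a::real_inner"
  shows "(norm (v - t *\<^sub>R u))\<^sup>2 = (norm v)\<^sup>2 - 2 * t * (v \<bullet> u) + t\<^sup>2 * (u \<bullet> u)"
  unfolding power2_norm_eq_inner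
  by (simp add: inner_diff_left inner_diff_right inner_commute algebra_simps power2_eq_square)

text \<open>
  The projection is the limit of a minimising sequence for the distance to \<open>S\<close>, which is a Cauchy
  sequence by the parallelogram law.
\<close>

lemma orthogonal_projection_exists:
  fixes S :: "'a::{real_inner, complete_space} set"
  assumes S: "subspace S" and "closed S"
  obtains p where "p \<in> S" and "\<And>s. s \<in> S \<Longrightarrow> (x - p) \<bullet> s = 0"
proof -
  define d where "d = infdist x S"
  have ne: "S \<noteq> {}"
    using S subspace_0 by blast
  have d_le: "d \<le> norm (x - s)" if "s \<in> S" for s
    using infdist_le[OF that, of x] by (simp add: d_def dist_norm)
  have "\<exists>s\<in>S. norm (x - s) < d + inverse (real (Suc n))" for n
  proof (rule ccontr)
    assume "\<not> ?thesis"
    then have "d + inverse (real (Suc n)) \<le> dist x s" if "s \<in> S" for s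
      using that by (fastforce simp: dist_norm)
    then have "d + inverse (real (Suc n)) \<le> infdist x S"
      using ne by (auto simp: infdist_def intro: cINF_greatest)
    then show False
      by (simp add: d_def add_increasing)
  qed
  then obtain s where sS: "\<And>n. s n \<in> S"
    and s_less: "\<And>n. norm (x - s n) < d + inverse (real (Suc n))"
    by metis
  have d0: "0 \<le> d"
    by (simp add: d_def infdist_nonneg)
  have lim: "(\<lambda>n. norm (x - s n)) \<longlonglongrightarrow> d"
  proof (rule tendsto_sandwich[OF _ _ tendsto_const])
    show "(\<lambda>n. d + inverse (real (Suc n))) \<longlonglongrightarrow> d"
      using tendsto_add[OF tendsto_const LIMSEQ_inverse_real_of_nat, of d] by simp
  qed (use d_le sS s_less in \<open>auto intro!: always_eventually less_imp_le\<close>)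
  have par: "(norm (s m - s n))\<^sup>2 \<le> 2 * ((norm (x - s m))\<^sup>2 - d\<^sup>2) + 2 * ((norm (x - s n))\<^sup>2 - d\<^sup>2)"
    for m n
  proof -
    have "(1/2) *\<^sub>R (s m + s n) \<in> S"
      using S sS by (intro subspace_scale subspace_add)
    then have "d \<le> norm (x - (1/2) *\<^sub>R (s m + s n))"
      by (rule d_le)
    then have "d\<^sup>2 \<le> (norm (x - (1/2) *\<^sub>R (s m + s n)))\<^sup>2"
      using d0 by (rule power_mono)
    moreover have "(norm (s m - s n))\<^sup>2 + 4 * (norm (x - (1/2) *\<^sub>R (s m + s n)))\<^sup>2
        = 2 * (norm (x - s m))\<^sup>2 + 2 * (norm (x - s n))\<^sup>2"
      by (simp add: power2_norm_eq_inner inner_diff_left inner_diff_right inner_add_left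
          inner_add_right inner_commute algebra_simps)
    ultimately show ?thesis by simp
  qed
  have "Cauchy s"
  proof (rule metric_CauchyI)
    fix e :: real assume "0 < e"
    have "(\<lambda>n. (norm (x - s n))\<^sup>2) \<longlonglongrightarrow> d\<^sup>2"
      by (intro tendsto_power lim)
    then have "eventually (\<lambda>n. (norm (x - s n))\<^sup>2 < d\<^sup>2 + e\<^sup>2 / 4) sequentially"
      using \<open>0 < e\<close> by (intro order_tendstoD) auto
    then obtain M where M: "\<And>n. n \<ge> M \<Longrightarrow> (norm (x - s n))\<^sup>2 < d\<^sup>2 + e\<^sup>2 / 4"
      by (auto simp: eventually_sequentially)
    have "dist (s m) (s n) < e" if "m \<ge> M" "n \<ge> M" for m n
    proof -
      have "(norm (s m - s n))\<^sup>2 < e\<^sup>2"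
        using par[of m n] M[OF that(1)] M[OF that(2)] by simp
      then show ?thesis
        using \<open>0 < e\<close> by (simp add: dist_norm power2_less_imp_less)
    qed
    then show "\<exists>M. \<forall>m\<ge>M. \<forall>n\<ge>M. dist (s m) (s n) < e" by blast
  qed
  then obtain p where p: "s \<longlonglongrightarrow> p"
    by (meson Cauchy_convergent convergent_def)
  have pS: "p \<in> S"
    using \<open>closed S\<close> p sS by (metis closed_sequentially)
  have "(\<lambda>n. norm (x - s n)) \<longlonglongrightarrow> norm (x - p)"
    by (intro tendsto_intros p)
  then have np: "norm (x - p) = d"
    using lim LIMSEQ_unique by blast
  have "(x - p) \<bullet> u = 0" if u: "u \<in> S" for u
  proof (rule ccontr)
    assume ne0: "(x - p) \<bullet> u \<noteq> 0"
    then have uu: "u \<bullet> u > 0"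
      by (metis inner_gt_zero_iff inner_zero_right)
    define t where "t = ((x - p) \<bullet> u) / (u \<bullet> u)"
    have "p + t *\<^sub>R u \<in> S"
      using S pS u by (intro subspace_add subspace_scale)
    then have "d \<le> norm ((x - p) - t *\<^sub>R u)"
      using d_le by (metis diff_diff_eq)
    then have "d\<^sup>2 \<le> (norm ((x - p) - t *\<^sub>R u))\<^sup>2"
      using d0 by (rule power_mono)
    also have "\<dots> = (norm (x - p))\<^sup>2 - 2 * t * ((x - p) \<bullet> u) + t\<^sup>2 * (u \<bullet> u)"
      by (rule power2_norm_diff_scaleR)
    also have "\<dots> = d\<^sup>2 - ((x - p) \<bullet> u)\<^sup>2 / (u \<bullet> u)"
      using uu by (simp add: t_def np field_simps power2_eq_square)
    finally have "((x - p) \<bullet> u)\<^sup>2 / (u \<bullet> u) \<le> 0" by simp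
    moreover have "((x - p) \<bullet> u)\<^sup>2 / (u \<bullet> u) > 0"
      using uu ne0 by simp
    ultimately show False by linarith
  qed
  then show thesis
    using that pS by blast
qed

section \<open>Adjoints and normal operators\<close>

lemma cinner_zero_right: "cinner x 0 = 0"
  using cinner_diff_right[of x 0 0] by simp

lemma hilbert_subspaceD:
  assumes "hilbert_subspace H"
  shows "0 \<in> H" "x \<in> H \<Longrightarrow> y \<in> H \<Longrightarrow> x + y \<in> H" "x \<in> H \<Longrightarrow> y \<in> H \<Longrightarrow> x - y \<in> H"
    "x \<in> H \<Longrightarrow> c *\<^sub>C x \<in> H" "closed H"
proof -
  have sub: "complex_vector.subspace H"
    using assms unfolding hilbert_subspace_def by blast
  show "0 \<in> H" "x \<in> H \<Longrightarrow> y \<in> H \<Longrightarrow> x + y \<in> H" "x \<in> H \<Longrightarrow> y \<in> H \<Longrightarrow> x - y \<in> H"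
    "x \<in> H \<Longrightarrow> c *\<^sub>C x \<in> H"
    using complex_vector.subspace_0[OF sub] complex_vector.subspace_add[OF sub]
      complex_vector.subspace_diff[OF sub] complex_vector.subspace_scale[OF sub] by simp_all
qed (use assms in \<open>auto simp: hilbert_subspace_def\<close>)

lemma linear_opD:
  assumes "linear_op H K T"
  shows "complex_vector.subspace (domain T)" "0 \<in> domain T"
    "x \<in> domain T \<Longrightarrow> y \<in> domain T \<Longrightarrow> x + y \<in> domain T"
    "x \<in> domain T \<Longrightarrow> y \<in> domain T \<Longrightarrow> x - y \<in> domain T"
    "x \<in> domain T \<Longrightarrow> c *\<^sub>C x \<in> domain T"
    "x \<in> domain T \<Longrightarrow> x \<in> H" "x \<in> domain T \<Longrightarrow> app T x \<in> K"
    "x \<in> domain T \<Longrightarrow> y \<in> domain T \<Longrightarrow> app T (x + y) = app T x + app T y"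
    "x \<in> domain T \<Longrightarrow> app T (c *\<^sub>C x) = c *\<^sub>C app T x"
proof -
  show sub: "complex_vector.subspace (domain T)"
    using assms unfolding linear_op_def by blast
  show "0 \<in> domain T" "x \<in> domain T \<Longrightarrow> y \<in> domain T \<Longrightarrow> x + y \<in> domain T"
    "x \<in> domain T \<Longrightarrow> y \<in> domain T \<Longrightarrow> x - y \<in> domain T"
    "x \<in> domain T \<Longrightarrow> c *\<^sub>C x \<in> domain T"
    using complex_vector.subspace_0[OF sub] complex_vector.subspace_add[OF sub]
      complex_vector.subspace_diff[OF sub] complex_vector.subspace_scale[OF sub] by simp_all
  show "x \<in> domain T \<Longrightarrow> x \<in> H" "x \<in> domain T \<Longrightarrow> app T x \<in> K"
    "x \<in> domain T \<Longrightarrow> y \<in> domain T \<Longrightarrow> app T (x + y) = app T x + app T y"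
    "x \<in> domain T \<Longrightarrow> app T (c *\<^sub>C x) = c *\<^sub>C app T x"
    using assms unfolding linear_op_def by blast+
qed

lemma linear_op_diff:
  assumes "linear_op H K T" "x \<in> domain T" "y \<in> domain T"
  shows "app T (x - y) = app T x - app T y"
proof -
  have "app T (x - y) + app T y = app T x"
    using linear_opD(8)[OF assms(1) linear_opD(4)[OF assms] assms(3)] by simp
  then show ?thesis
    by (simp add: algebra_simps)
qed

lemma subspace_closure:
  fixes S :: "'a::real_normed_vector set"
  assumes "subspace S"
  shows "subspace (closure S)"
proof (rule subspaceI)
  show "0 \<in> closure S"
    using assms closure_subset subspace_0 by blast
  show "x + y \<in> closure S" if xy: "x \<in> closure S" "y \<in> closure S" for x y
  proof -
    obtain f g where "\<And>n. f n \<in> S" "f \<longlonglongrightarrow> x" "\<And>n. g n \<in> S" "g \<longlonglongrightarrow> y"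
      using xy unfolding closure_sequential by blast
    then have "(\<lambda>n. f n + g n) \<longlonglongrightarrow> x + y" "\<forall>n. f n + g n \<in> S"
      using assms by (auto intro: tendsto_add subspace_add)
    then show ?thesis
      unfolding closure_sequential by (intro exI[where x = "\<lambda>n. f n + g n"]) simp
  qed
  show "r *\<^sub>R x \<in> closure S" if x: "x \<in> closure S" for r x
  proof -
    obtain f where "\<And>n. f n \<in> S" "f \<longlonglongrightarrow> x"
      using x unfolding closure_sequential by blast
    then have "(\<lambda>n. r *\<^sub>R f n) \<longlonglongrightarrow> r *\<^sub>R x" "\<forall>n. r *\<^sub>R f n \<in> S"
      using assms by (auto intro: tendsto_scaleR subspace_scale)
    then show ?thesis
      unfolding closure_sequential by (intro exI[where x = "\<lambda>n. r *\<^sub>R f n"]) simp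
  qed
qed

locale closed_densely_defined =
  fixes H :: "'a::complex_hilbert set" and T :: "('a, 'a) unbounded_op"
  assumes H: "hilbert_subspace H"
    and lin: "linear_op H H T"
    and dense: "densely_defined H T"
    and closed: "closed_op T"
begin

lemmas T_simps = linear_opD(3-)[OF lin] linear_op_diff[OF lin]
lemmas H_simps = hilbert_subspaceD[OF H]

lemma eq_if_cinner_eq:
  assumes "z \<in> H" "z' \<in> H" and eq: "\<And>x. x \<in> domain T \<Longrightarrow> cinner x z = cinner x z'"
  shows "z = z'"
proof -
  have "z - z' \<in> closure (domain T)"
    using dense H_simps(3)[OF assms(1,2)] unfolding densely_defined_def by blast
  then obtain s where s: "\<And>n. s n \<in> domain T" and "s \<longlonglongrightarrow> z - z'"
    by (auto simp: closure_sequential)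
  then have "(\<lambda>n. cinner (s n) (z - z')) \<longlonglongrightarrow> cinner (z - z') (z - z')"
    by (intro tendsto_cinner_left)
  moreover have "cinner (s n) (z - z') = 0" for n
    using eq[OF s] by (simp add: cinner_diff_right)
  ultimately have "cinner (z - z') (z - z') = 0"
    by (simp add: LIMSEQ_const_iff)
  then show ?thesis
    by (simp add: cinner_self)
qed

lemma adjoint_op_eqI:
  assumes "y \<in> H" "z \<in> H" and eq: "\<And>x. x \<in> domain T \<Longrightarrow> cinner (app T x) y = cinner x z"
  shows "y \<in> domain (adjoint_op H T)" and "app (adjoint_op H T) y = z"
proof -
  show "y \<in> domain (adjoint_op H T)"
    using assms by (auto simp: adjoint_op_def)
  have "(THE z. z \<in> H \<and> (\<forall>x\<in>domain T. cinner (app T x) y = cinner x z)) = z"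
    using assms by (intro the_equality) (auto intro: eq_if_cinner_eq)
  then show "app (adjoint_op H T) y = z"
    by (simp add: adjoint_op_def)
qed

lemma adjoint_opD:
  assumes "y \<in> domain (adjoint_op H T)"
  shows "y \<in> H" "app (adjoint_op H T) y \<in> H"
    "x \<in> domain T \<Longrightarrow> cinner (app T x) y = cinner x (app (adjoint_op H T) y)"
proof -
  obtain z where "y \<in> H" "z \<in> H" "\<forall>x\<in>domain T. cinner (app T x) y = cinner x z"
    using assms by (auto simp: adjoint_op_def)
  then show "y \<in> H" "app (adjoint_op H T) y \<in> H"
    "x \<in> domain T \<Longrightarrow> cinner (app T x) y = cinner x (app (adjoint_op H T) y)"
    using adjoint_op_eqI(2) by auto
qed

lemma linear_op_adjoint_op: "linear_op H H (adjoint_op H T)"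
proof -
  let ?S = "adjoint_op H T"
  have add: "x + y \<in> domain ?S \<and> app ?S (x + y) = app ?S x + app ?S y"
    if "x \<in> domain ?S" "y \<in> domain ?S" for x y
  proof -
    have "cinner (app T u) (x + y) = cinner u (app ?S x + app ?S y)" if "u \<in> domain T" for u
      using that \<open>x \<in> domain ?S\<close> \<open>y \<in> domain ?S\<close> by (simp add: cinner_add_right adjoint_opD(3))
    then show ?thesis
      using adjoint_op_eqI[of "x + y" "app ?S x + app ?S y"] that
      by (simp add: H_simps(2) adjoint_opD(1,2))
  qed
  have scale: "c *\<^sub>C x \<in> domain ?S \<and> app ?S (c *\<^sub>C x) = c *\<^sub>C app ?S x"
    if "x \<in> domain ?S" for c x
  proof -
    have "cinner (app T u) (c *\<^sub>C x) = cinner u (c *\<^sub>C app ?S x)" if "u \<in> domain T" for u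
      using that \<open>x \<in> domain ?S\<close> by (simp add: cinner_scaleC_right adjoint_opD(3))
    then show ?thesis
      using adjoint_op_eqI[of "c *\<^sub>C x" "c *\<^sub>C app ?S x"] that
      by (simp add: H_simps(4) adjoint_opD(1,2))
  qed
  have "0 \<in> domain ?S"
    using adjoint_op_eqI(1)[of 0 0] H_simps(1) by (simp add: cinner_zero_right)
  moreover have "domain ?S \<subseteq> H" "app ?S ` domain ?S \<subseteq> H"
    using adjoint_opD(1,2) by blast+
  ultimately show ?thesis
    using add scale unfolding linear_op_def complex_vector.subspace_def by blast
qed

text \<open>The domain of \<open>T\<^sup>* T\<close>, as a set.\<close>

definition domain_sq :: "'a set"
  where "domain_sq = {x \<in> domain T. app T x \<in> domain (adjoint_op H T)}"

lemma subspace_domain_sq: "complex_vector.subspace domain_sq"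
  unfolding complex_vector.subspace_def domain_sq_def
  using linear_opD(2)[OF lin] linear_opD(9)[OF lin, of 0 0] linear_opD(2,3,5)[OF linear_op_adjoint_op]
  by (simp add: T_simps)

lemma subspace_graph:
  assumes "complex_vector.subspace S" and "S \<subseteq> domain T"
  shows "subspace {(x, app T x) |x. x \<in> S}"
proof (rule subspaceI)
  have "app T 0 = 0"
    using linear_opD(2)[OF lin] linear_opD(9)[OF lin, of 0 0] by simp
  then show "0 \<in> {(x, app T x) |x. x \<in> S}"
    using complex_vector.subspace_0[OF assms(1)] by (auto simp: zero_prod_def)
  show "v + w \<in> {(x, app T x) |x. x \<in> S}"
    if "v \<in> {(x, app T x) |x. x \<in> S}" and "w \<in> {(x, app T x) |x. x \<in> S}" for v w
  proof -
    obtain x y where "x \<in> S" "y \<in> S" and vw: "v = (x, app T x)" "w = (y, app T y)"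
      using \<open>v \<in> _\<close> \<open>w \<in> _\<close> by blast
    then have "x + y \<in> S" "app T x + app T y = app T (x + y)"
      using complex_vector.subspace_add[OF assms(1)] assms(2) T_simps(6) by (simp_all add: subset_iff)
    then show ?thesis
      by (auto simp: vw)
  qed
  show "r *\<^sub>R v \<in> {(x, app T x) |x. x \<in> S}"
    if "v \<in> {(x, app T x) |x. x \<in> S}" for r v
  proof -
    obtain x where "x \<in> S" and v: "v = (x, app T x)"
      using \<open>v \<in> _\<close> by blast
    then have "r *\<^sub>R x \<in> S" "r *\<^sub>R app T x = app T (r *\<^sub>R x)"
      using complex_vector.subspace_scale[OF assms(1), of x "complex_of_real r"] assms(2)
        T_simps(7)[of x "complex_of_real r"] by (auto simp: scaleC_of_real)
    then show ?thesis
      by (auto simp: v)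
  qed
qed

text \<open>
  Von Neumann's theorem: \<open>1 + T\<^sup>* T\<close> maps onto \<open>H\<close>. The preimage of \<open>y\<close> is the first component of
  the orthogonal projection of \<open>(y, 0)\<close> onto the graph of \<open>T\<close>.
\<close>

lemma one_plus_adjoint_comp_surj:
  assumes y: "y \<in> H"
  obtains x where "x \<in> domain_sq" "x + app (adjoint_op H T) (app T x) = y"
proof -
  obtain q where q: "q \<in> {(x, app T x) |x. x \<in> domain T}"
    and orth: "\<And>s. s \<in> {(x, app T x) |x. x \<in> domain T} \<Longrightarrow> ((y, 0) - q) \<bullet> s = 0"
    using orthogonal_projection_exists[OF subspace_graph[OF linear_opD(1)[OF lin] order_refl]
        closed[unfolded closed_op_def], of "(y, 0)"] by blast
  then obtain x where x: "x \<in> domain T" and qx: "q = (x, app T x)" by blast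
  have "app T u \<bullet> app T x = u \<bullet> (y - x)" if "u \<in> domain T" for u
    using orth[of "(u, app T u)"] that
    by (auto simp: qx inner_Pair inner_diff_left inner_diff_right inner_commute algebra_simps)
  then have "cinner (app T u) (app T x) = cinner u (y - x)" if "u \<in> domain T" for u
    using that linear_opD(1)[OF lin] T_simps(7)
    by (intro cinner_eq_if_inner_eq[where S = "domain T"]) simp_all
  then have "app T x \<in> domain (adjoint_op H T)" "app (adjoint_op H T) (app T x) = y - x"
    using adjoint_op_eqI[of "app T x" "y - x"] x y by (simp_all add: T_simps H_simps)
  then show thesis
    using that x by (auto simp: domain_sq_def)
qed

text \<open>The domain of \<open>T\<^sup>* T\<close> is a core of \<open>T\<close>.\<close>

lemma domain_sq_core:
  assumes x: "x \<in> domain T"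
  obtains s where "\<And>n. s n \<in> domain_sq" "s \<longlonglongrightarrow> x" "(\<lambda>n. app T (s n)) \<longlonglongrightarrow> app T x"
proof -
  let ?G = "{(x, app T x) |x. x \<in> domain T}"
  let ?G2 = "{(x, app T x) |x. x \<in> domain_sq}"
  have sub: "subspace ?G2"
    by (rule subspace_graph[OF subspace_domain_sq]) (auto simp: domain_sq_def)
  have "?G2 \<subseteq> ?G" by (auto simp: domain_sq_def)
  then have cl: "closure ?G2 \<subseteq> ?G"
    using closed[unfolded closed_op_def] by (rule closure_minimal)
  obtain q where q: "q \<in> closure ?G2"
    and orth: "\<And>s. s \<in> closure ?G2 \<Longrightarrow> ((x, app T x) - q) \<bullet> s = 0"
    using orthogonal_projection_exists[OF subspace_closure[OF sub] closed_closure, of "(x, app T x)"] by blast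
  from q cl obtain x' where x': "x' \<in> domain T" and qx: "q = (x', app T x')" by blast
  have xx: "x - x' \<in> H" "x - x' \<in> domain T"
    using x x' by (simp_all add: T_simps)
  obtain u where u: "u \<in> domain_sq" "u + app (adjoint_op H T) (app T u) = x - x'"
    by (rule one_plus_adjoint_comp_surj[OF xx(1)])
  have "(u, app T u) \<in> closure ?G2"
    using u(1) by (intro set_mp[OF closure_subset]) blast
  from orth[OF this] have "0 = (x - x') \<bullet> u + app T (x - x') \<bullet> app T u"
    using x x' by (simp add: qx T_simps)
  also have "app T (x - x') \<bullet> app T u = (x - x') \<bullet> app (adjoint_op H T) (app T u)"
  proof -
    have "app T u \<in> domain (adjoint_op H T)"
      using u(1) by (simp add: domain_sq_def)
    from adjoint_opD(3)[OF this xx(2)] show ?thesis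
      by (simp flip: Re_cinner)
  qed
  also have "(x - x') \<bullet> u + \<dots> = (x - x') \<bullet> (x - x')"
    unfolding inner_add_right[symmetric] u(2) ..
  finally have "q = (x, app T x)"
    using qx by simp
  with q have "(x, app T x) \<in> closure ?G2" by simp
  then obtain s where s: "\<And>n. s n \<in> ?G2" and lim: "s \<longlonglongrightarrow> (x, app T x)"
    unfolding closure_sequential by blast
  have s': "fst (s n) \<in> domain_sq" "snd (s n) = app T (fst (s n))" for n
    using s[of n] by auto
  show thesis
  proof (rule that)
    show "(\<lambda>n. fst (s n)) \<longlonglongrightarrow> x"
      using tendsto_fst[OF lim] by simp
    show "(\<lambda>n. app T (fst (s n))) \<longlonglongrightarrow> app T x"
      using tendsto_snd[OF lim] by (simp add: s')
  qed (rule s')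
qed

end

text \<open>
  A normal operator satisfies \<open>D(T) \<subseteq> D(T\<^sup>*)\<close> and \<open>\<parallel>T\<^sup>* x\<parallel> = \<parallel>T x\<parallel>\<close>: on \<open>D(T\<^sup>* T)\<close> the equality follows from
  \<open>\<langle>T\<^sup>* T x, x\<rangle> = \<langle>T T\<^sup>* x, x\<rangle>\<close>, and it passes to \<open>D(T)\<close> because \<open>D(T\<^sup>* T)\<close> is a core of \<open>T\<close>.
\<close>

lemma normal_op_adjoint:
  assumes H: "hilbert_subspace H" and lin: "linear_op H H T" and normal: "normal_op H T"
    and x: "x \<in> domain T"
  shows "x \<in> domain (adjoint_op H T)" "norm (app (adjoint_op H T) x) = norm (app T x)"
proof -
  let ?S = "adjoint_op H T"
  interpret closed_densely_defined H T
    using assms by unfold_locales (auto simp: normal_op_def)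
  have sq: "u \<in> domain T" "u \<in> domain ?S" "norm (app ?S u) = norm (app T u)"
    if "u \<in> domain_sq" for u
  proof -
    have "op_eq (op_comp ?S T) (op_comp T ?S)"
      using normal by (simp add: normal_op_def)
    then have u: "u \<in> domain T" "app T u \<in> domain ?S" "u \<in> domain ?S" "app ?S u \<in> domain T"
      "app ?S (app T u) = app T (app ?S u)"
      using that by (auto simp: op_eq_def op_comp_def domain_sq_def)
    then show "u \<in> domain T" "u \<in> domain ?S" by simp_all
    have "cinner (app T u) (app T u) = cinner u (app T (app ?S u))"
      using adjoint_opD(3)[OF u(2) u(1)] u(5) by simp
    also have "\<dots> = cnj (cinner (app T (app ?S u)) u)"
      by (rule cinner_commute)
    also have "\<dots> = cnj (cinner (app ?S u) (app ?S u))"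
      using adjoint_opD(3)[OF u(3) u(4)] by simp
    also have "\<dots> = cinner (app ?S u) (app ?S u)"
      by (rule cinner_commute[symmetric])
    finally have "(norm (app T u))\<^sup>2 = (norm (app ?S u))\<^sup>2"
      unfolding cinner_self of_real_eq_iff .
    then show "norm (app ?S u) = norm (app T u)"
      by (simp add: power2_eq_iff_nonneg)
  qed
  obtain s where s: "\<And>n. s n \<in> domain_sq" and lim: "s \<longlonglongrightarrow> x"
    and limT: "(\<lambda>n. app T (s n)) \<longlonglongrightarrow> app T x"
    using domain_sq_core[OF x] by metis
  have "dist (app ?S (s m)) (app ?S (s n)) = dist (app T (s m)) (app T (s n))" for m n
  proof -
    have "s m - s n \<in> domain_sq"
      by (intro complex_vector.subspace_diff[OF subspace_domain_sq] s)
    then have "norm (app ?S (s m - s n)) = norm (app T (s m - s n))"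
      by (rule sq(3))
    then show ?thesis
      using linear_op_diff[OF linear_op_adjoint_op sq(2)[OF s] sq(2)[OF s]]
        T_simps(8)[OF sq(1)[OF s] sq(1)[OF s]] by (simp add: dist_norm)
  qed
  then have "Cauchy (\<lambda>n. app ?S (s n))"
    using LIMSEQ_imp_Cauchy[OF limT] unfolding Cauchy_def by simp
  then obtain z where z: "(\<lambda>n. app ?S (s n)) \<longlonglongrightarrow> z"
    by (meson Cauchy_convergent convergent_def)
  have zH: "z \<in> H"
    by (rule closed_sequentially[OF H_simps(5) _ z]) (intro adjoint_opD(2) sq(2) s)
  have "cinner (app T u) x = cinner u z" if "u \<in> domain T" for u
  proof (rule LIMSEQ_unique)
    show "(\<lambda>n. cinner (app T u) (s n)) \<longlonglongrightarrow> cinner (app T u) x"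
      by (intro tendsto_cinner_right lim)
    have "(\<lambda>n. cinner u (app ?S (s n))) \<longlonglongrightarrow> cinner u z"
      by (intro tendsto_cinner_right z)
    then show "(\<lambda>n. cinner (app T u) (s n)) \<longlonglongrightarrow> cinner u z"
      using adjoint_opD(3)[OF sq(2)[OF s] that] by simp
  qed
  then have xS: "x \<in> domain ?S" and Sx: "app ?S x = z"
    using adjoint_op_eqI[of x z] T_simps(4)[OF x] zH by simp_all
  have "(\<lambda>n. norm (app ?S (s n))) \<longlonglongrightarrow> norm z" "(\<lambda>n. norm (app T (s n))) \<longlonglongrightarrow> norm (app T x)"
    by (intro tendsto_norm z limT)+
  then show "norm (app ?S x) = norm (app T x)"
    using sq(3)[OF s] LIMSEQ_unique unfolding Sx by simp
  show "x \<in> domain ?S" by (rule xS)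
qed

text \<open>
  Hence every resolvent \<open>R\<close> of a normal operator is paranormal, that is
  \<open>\<parallel>R y\<parallel>\<^sup>2 \<le> \<parallel>R\<^sup>2 y\<parallel> \<parallel>y\<parallel>\<close>: take \<open>v = R\<^sup>2 y\<close> and \<open>w = R y\<close> below. The proof moves one factor \<open>T - z\<close> of
  \<open>\<langle>(T - z) v, w\<rangle>\<close> to the other side and uses \<open>\<parallel>(T - z)\<^sup>* w\<parallel> = \<parallel>(T - z) w\<parallel>\<close>.
\<close>

lemma normal_op_paranormal:
  assumes H: "hilbert_subspace H" and lin: "linear_op H H T" and normal: "normal_op H T"
    and v: "v \<in> domain T" and w: "app T v - z *\<^sub>C v = w" "w \<in> domain T"
  shows "(norm w)\<^sup>2 \<le> norm v * norm (app T w - z *\<^sub>C w)"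
proof -
  let ?S = "adjoint_op H T"
  interpret closed_densely_defined H T
    using assms by unfold_locales (auto simp: normal_op_def)
  have w': "w \<in> domain ?S" "norm (app ?S w) = norm (app T w)"
    using normal_op_adjoint[OF H lin normal w(2)] .
  have eq: "norm (app ?S w - cnj z *\<^sub>C w) = norm (app T w - z *\<^sub>C w)"
  proof -
    have "cinner (app T w) (z *\<^sub>C w) = cnj z * cinner w (app ?S w)"
      using adjoint_opD(3)[OF w'(1) w(2)] by (simp add: cinner_scaleC_right)
    also have "\<dots> = cnj (cinner (app ?S w) (cnj z *\<^sub>C w))"
      using cinner_commute[of w "app ?S w"] by (simp add: cinner_scaleC_right)
    finally have "app T w \<bullet> (z *\<^sub>C w) = app ?S w \<bullet> (cnj z *\<^sub>C w)"
      by (simp flip: Re_cinner)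
    moreover have "(norm (a - b))\<^sup>2 = (norm a)\<^sup>2 - 2 * (a \<bullet> b) + (norm b)\<^sup>2" for a b :: 'a
      using power2_norm_diff_scaleR[of a 1 b] by (simp add: power2_norm_eq_inner)
    ultimately have "(norm (app ?S w - cnj z *\<^sub>C w))\<^sup>2 = (norm (app T w - z *\<^sub>C w))\<^sup>2"
      by (simp add: w'(2) norm_scaleC)
    then show ?thesis
      by (simp add: power2_eq_iff_nonneg)
  qed
  have "cinner w w = cinner (app T v) w - z * cinner v w"
    unfolding w(1)[symmetric] by (simp add: cinner_diff_left cinner_scaleC_left)
  also have "\<dots> = cinner v (app ?S w - cnj z *\<^sub>C w)"
    using adjoint_opD(3)[OF w'(1) v] by (simp add: cinner_diff_right cinner_scaleC_right)
  finally have "complex_of_real ((norm w)\<^sup>2) = cinner v (app ?S w - cnj z *\<^sub>C w)"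
    by (simp only: cinner_self)
  then have "(norm w)\<^sup>2 = norm (cinner v (app ?S w - cnj z *\<^sub>C w))"
    by (metis abs_power2 norm_of_real)
  also have "\<dots> \<le> norm v * norm (app T w - z *\<^sub>C w)"
    using cinner_Cauchy_Schwarz eq by metis
  finally show ?thesis .
qed

section \<open>Resolvents\<close>

lemma resolvent_setD:
  assumes "z \<in> resolvent_set H T" and "y \<in> H"
  shows "resolvent T z y \<in> domain T" "app T (resolvent T z y) - z *\<^sub>C resolvent T z y = y"
proof -
  have "y \<in> (\<lambda>x. app T x - z *\<^sub>C x) ` domain T"
    using assms by (simp add: resolvent_set_def bij_betw_def)
  then show "resolvent T z y \<in> domain T" "app T (resolvent T z y) - z *\<^sub>C resolvent T z y = y"
    unfolding resolvent_def by (rule inv_into_into, rule f_inv_into_f)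
qed

lemma resolvent_eqI:
  assumes "z \<in> resolvent_set H T" and "x \<in> domain T" and "app T x - z *\<^sub>C x = y"
  shows "resolvent T z y = x"
  using assms unfolding resolvent_def resolvent_set_def bij_betw_def
  by (auto intro: inv_into_f_eq)

lemma resolvent_bound:
  assumes "z \<in> resolvent_set H T"
  obtains C where "0 < C" "\<And>y. y \<in> H \<Longrightarrow> norm (resolvent T z y) \<le> C * norm y"
proof -
  obtain C where C: "\<forall>y\<in>H. norm (resolvent T z y) \<le> C * norm y"
    using assms by (auto simp: resolvent_set_def)
  have "norm (resolvent T z y) \<le> (\<bar>C\<bar> + 1) * norm y" if "y \<in> H" for y
  proof -
    have "C * norm y \<le> (\<bar>C\<bar> + 1) * norm y"
      by (rule mult_right_mono) auto
    then show ?thesis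
      using order_trans[OF C[rule_format, OF that]] by blast
  qed
  then show thesis
    by (intro that[of "\<bar>C\<bar> + 1"]) auto
qed

lemma resolvent_identity:
  assumes H: "hilbert_subspace H" and lin: "linear_op H H T"
    and w: "w \<in> resolvent_set H T" and z: "z \<in> resolvent_set H T" and y: "y \<in> H"
  shows "resolvent T w y = resolvent T z (y + (w - z) *\<^sub>C resolvent T w y)"
    and "resolvent T w y = resolvent T z y + (w - z) *\<^sub>C resolvent T z (resolvent T w y)"
proof -
  note R = resolvent_setD[OF w y]
  have RH: "resolvent T w y \<in> H"
    using R(1) lin by (simp add: linear_opD(6))
  have "app T (resolvent T w y) = y + w *\<^sub>C resolvent T w y"
    using R(2) by (simp add: diff_eq_eq)
  then show fixed: "resolvent T w y = resolvent T z (y + (w - z) *\<^sub>C resolvent T w y)"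
    by (intro resolvent_eqI[OF z R(1), symmetric])
      (simp add: complex_vector.scale_left_diff_distrib)
  define u where "u = resolvent T z y + (w - z) *\<^sub>C resolvent T z (resolvent T w y)"
  note Z = resolvent_setD[OF z y] resolvent_setD[OF z RH]
  have u: "u \<in> domain T"
    using Z linear_opD[OF lin] by (simp add: u_def)
  have "app T u - z *\<^sub>C u = (app T (resolvent T z y) - z *\<^sub>C resolvent T z y)
      + (w - z) *\<^sub>C (app T (resolvent T z (resolvent T w y)) - z *\<^sub>C resolvent T z (resolvent T w y))"
  proof -
    have "app T u = app T (resolvent T z y) + (w - z) *\<^sub>C app T (resolvent T z (resolvent T w y))"
      unfolding u_def using Z(1,3) by (simp add: linear_opD[OF lin])
    then show ?thesis
      by (simp add: u_def complex_vector.scale_right_diff_distrib complex_vector.scale_right_distrib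
          complex_vector.scale_left_commute[of z])
  qed
  also have "\<dots> = y + (w - z) *\<^sub>C resolvent T w y"
    using Z by simp
  finally have "resolvent T z (y + (w - z) *\<^sub>C resolvent T w y) = u"
    by (rule resolvent_eqI[OF z u])
  then show "resolvent T w y = resolvent T z y + (w - z) *\<^sub>C resolvent T z (resolvent T w y)"
    using fixed unfolding u_def by (rule trans[rotated])
qed

lemma continuous_on_resolvent:
  assumes H: "hilbert_subspace H" and lin: "linear_op H H T" and y: "y \<in> H"
  shows "continuous_on (resolvent_set H T) (\<lambda>w. resolvent T w y)"
  unfolding continuous_on_def
proof
  fix z assume z: "z \<in> resolvent_set H T"
  let ?F = "at z within resolvent_set H T"
  obtain C where C: "0 < C" "\<And>y. y \<in> H \<Longrightarrow> norm (resolvent T z y) \<le> C * norm y"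
    using resolvent_bound[OF z] by metis
  have "norm (resolvent T w y - resolvent T z y) \<le> norm (w - z) * (2 * C\<^sup>2 * norm y)"
    if w: "w \<in> resolvent_set H T" and small: "norm (w - z) < 1 / (2 * C)" for w
  proof -
    have RH: "resolvent T w y \<in> H"
      using resolvent_setD(1)[OF w y] linear_opD(6)[OF lin] by blast
    have id: "resolvent T w y - resolvent T z y = (w - z) *\<^sub>C resolvent T z (resolvent T w y)"
      using arg_cong[OF resolvent_identity(2)[OF H lin w z y], of "\<lambda>u. u - resolvent T z y"]
      by (simp only: add_diff_cancel_left')
    have "norm (resolvent T w y - resolvent T z y) = norm (w - z) * norm (resolvent T z (resolvent T w y))"
      by (simp add: id norm_scaleC)
    also have "\<dots> \<le> norm (w - z) * (C * norm (resolvent T w y))"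
      by (intro mult_left_mono C RH) simp
    finally have 1: "norm (resolvent T w y - resolvent T z y) \<le> norm (w - z) * (C * norm (resolvent T w y))" .
    also have "\<dots> \<le> 1 / (2 * C) * (C * norm (resolvent T w y))"
      using small C(1) by (intro mult_right_mono) auto
    also have "\<dots> = norm (resolvent T w y) / 2"
      using C(1) by simp
    finally have "norm (resolvent T w y) \<le> 2 * norm (resolvent T z y)"
      using norm_triangle_ineq2[of "resolvent T w y" "resolvent T z y"] by linarith
    also have "\<dots> \<le> 2 * (C * norm y)"
      using C(2)[OF y] by simp
    finally have "norm (w - z) * (C * norm (resolvent T w y)) \<le> norm (w - z) * (C * (2 * (C * norm y)))"
      using C(1) by (intro mult_left_mono) auto
    with 1 show ?thesis
      by (simp add: power2_eq_square algebra_simps)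
  qed
  moreover have "\<forall>\<^sub>F w in ?F. w \<in> resolvent_set H T \<and> norm (w - z) < 1 / (2 * C)"
    unfolding eventually_at using C(1) by (intro exI[of _ "1 / (2 * C)"]) (simp add: dist_norm)
  ultimately have "\<forall>\<^sub>F w in ?F. norm (resolvent T w y - resolvent T z y) \<le> norm (w - z) * (2 * C\<^sup>2 * norm y)"
    by (simp add: eventually_mono)
  moreover have "((\<lambda>w. norm (w - z) * (2 * C\<^sup>2 * norm y)) \<longlongrightarrow> 0) ?F"
    by (auto intro!: tendsto_eq_intros)
  ultimately have "((\<lambda>w. resolvent T w y - resolvent T z y) \<longlongrightarrow> 0) ?F"
    by (rule Lim_null_comparison)
  then show "((\<lambda>w. resolvent T w y) \<longlongrightarrow> resolvent T z y) ?F"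
    by (rule Lim_null[THEN iffD2])
qed

lemma holomorphic_on_cinner_resolvent:
  assumes H: "hilbert_subspace H" and lin: "linear_op H H T" and y: "y \<in> H"
    and S: "open S" "S \<subseteq> resolvent_set H T"
  shows "(\<lambda>w. cinner (resolvent T w y) u) holomorphic_on S"
  unfolding holomorphic_on_open[OF S(1)]
proof
  fix z assume zS: "z \<in> S"
  then have z: "z \<in> resolvent_set H T"
    using S(2) by blast
  have RH: "resolvent T z y \<in> H"
    using resolvent_setD(1)[OF z y] linear_opD(6)[OF lin] by blast
  have "continuous_on S (\<lambda>w. resolvent T w (resolvent T z y))"
    using continuous_on_resolvent[OF H lin RH] S(2) by (rule continuous_on_subset)
  then have "((\<lambda>w. resolvent T w (resolvent T z y)) \<longlongrightarrow> resolvent T z (resolvent T z y)) (at z)"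
    using S(1) zS by (simp add: continuous_on_eq_continuous_at isCont_def)
  then have lim: "((\<lambda>w. cinner (resolvent T w (resolvent T z y)) u)
      \<longlongrightarrow> cinner (resolvent T z (resolvent T z y)) u) (at z)"
    by (rule tendsto_cinner_left)
  have "cinner (resolvent T w (resolvent T z y)) u
      = (cinner (resolvent T w y) u - cinner (resolvent T z y) u) / (w - z)"
    if w: "w \<in> S" "w \<noteq> z" for w
  proof -
    have "w \<in> resolvent_set H T"
      using w S(2) by blast
    then have "resolvent T z y = resolvent T w y + (z - w) *\<^sub>C resolvent T w (resolvent T z y)"
      by (rule resolvent_identity(2)[OF H lin z _ y])
    then have "cinner (resolvent T z y) u
        = cinner (resolvent T w y + (z - w) *\<^sub>C resolvent T w (resolvent T z y)) u"
      by (rule arg_cong)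
    then have "cinner (resolvent T z y) u
        = cinner (resolvent T w y) u + (z - w) * cinner (resolvent T w (resolvent T z y)) u"
      by (simp only: cinner_add_left cinner_scaleC_left)
    then show ?thesis
      using w(2) by (simp add: field_simps)
  qed
  then have ev: "\<forall>\<^sub>F w in at z. cinner (resolvent T w (resolvent T z y)) u
      = (cinner (resolvent T w y) u - cinner (resolvent T z y) u) / (w - z)"
    using S(1) zS unfolding eventually_at_topological by blast
  show "\<exists>f'. ((\<lambda>w. cinner (resolvent T w y) u) has_field_derivative f') (at z)"
    unfolding has_field_derivative_iff by (rule exI, rule Lim_transform_eventually[OF lim ev])
qed

text \<open>If \<open>f(w) = c + (w - z) g(w)\<close>, the Taylor coefficients of \<open>f\<close> at \<open>z\<close> are those of \<open>g\<close>, shifted.\<close>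

lemma higher_deriv_const_plus_mult:
  assumes f: "f holomorphic_on S" and g: "g holomorphic_on S" and S: "open S" "z \<in> S"
    and eq: "\<And>w. w \<in> S \<Longrightarrow> f w = c + (w - z) * g w"
  shows "(deriv ^^ Suc n) f z = of_nat (Suc n) * (deriv ^^ n) g z"
proof -
  have id: "(deriv ^^ i) (\<lambda>w. w - z) z = (if i = 1 then 1 else 0)" for i
  proof (cases i)
    case (Suc k)
    have "deriv (\<lambda>w. w - z) = (\<lambda>_. 1)"
      by (intro ext DERIV_imp_deriv) (auto intro!: derivative_eq_intros)
    then show ?thesis
      by (simp add: Suc funpow_Suc_right del: funpow.simps(2))
  qed simp
  have "(deriv ^^ Suc n) f z = (deriv ^^ Suc n) (\<lambda>w. c + (w - z) * g w) z"
    by (rule higher_deriv_transform_within_open[OF f _ S(1) S(2) eq])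
      (intro holomorphic_intros g)
  also have "\<dots> = (deriv ^^ Suc n) (\<lambda>_. c) z + (deriv ^^ Suc n) (\<lambda>w. (w - z) * g w) z"
    by (rule higher_deriv_add[OF _ _ S]) (intro holomorphic_intros g)+
  also have "(deriv ^^ Suc n) (\<lambda>_. c) z = 0"
    by (simp add: higher_deriv_const)
  also have "(deriv ^^ Suc n) (\<lambda>w. (w - z) * g w) z
      = (\<Sum>i = 0..Suc n. of_nat (Suc n choose i) * (deriv ^^ i) (\<lambda>w. w - z) z * (deriv ^^ (Suc n - i)) g z)"
    by (rule higher_deriv_mult[OF _ g S]) (intro holomorphic_intros)
  also have "\<dots> = (\<Sum>i\<in>{1}. of_nat (Suc n choose i) * (deriv ^^ i) (\<lambda>w. w - z) z * (deriv ^^ (Suc n - i)) g z)"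
    by (rule sum.mono_neutral_right) (auto simp: id simp del: funpow.simps(2))
  also have "\<dots> = of_nat (Suc n) * (deriv ^^ n) g z"
    by (simp add: id del: funpow.simps(2))
  finally show ?thesis by simp
qed

text \<open>
  The ratios of consecutive terms of a logarithmically convex sequence increase, so a first ratio
  above \<open>1 / r\<close> would make \<open>a n * r ^ n\<close> unbounded.
\<close>

lemma log_convex_first_ratio:
  fixes a :: "nat \<Rightarrow> real"
  assumes nonneg: "\<And>n. 0 \<le> a n" and conv: "\<And>n. (a (Suc n))\<^sup>2 \<le> a n * a (Suc (Suc n))"
    and bound: "\<And>n. a n * r ^ n \<le> C" and "0 < r"
  shows "r * a 1 \<le> a 0"
proof (rule ccontr)
  assume less: "\<not> r * a 1 \<le> a 0"
  have a1: "a 1 > 0"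
    using less nonneg[of 0] nonneg[of 1] by (cases "a 1 = 0") auto
  have a0: "a 0 > 0"
    using conv[of 0] nonneg[of 0] a1 by (cases "a 0 = 0") auto
  define q where "q = a 1 / a 0"
  have q: "q > 0" "q * r > 1"
    using a0 a1 less by (auto simp: q_def field_simps)
  have step: "a n > 0 \<and> q * a n \<le> a (Suc n)" for n
  proof (induction n)
    case 0
    then show ?case using a0 by (simp add: q_def)
  next
    case (Suc n)
    have pos: "a (Suc n) > 0"
      using Suc q by (smt (verit) mult_pos_pos)
    have "q * a (Suc n) * a n \<le> a (Suc n) * a (Suc n)"
      using Suc pos by (simp add: mult_ac)
    also have "\<dots> \<le> a (Suc (Suc n)) * a n"
      using conv[of n] by (simp add: power2_eq_square mult_ac)
    finally show ?case
      using Suc pos by auto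
  qed
  have grow: "(q * r) ^ n * a 0 \<le> a n * r ^ n" for n
  proof (induction n)
    case (Suc n)
    have "(q * r) ^ Suc n * a 0 \<le> q * r * (a n * r ^ n)"
      using Suc q \<open>0 < r\<close> by (simp add: mult.assoc)
    also have "\<dots> = (q * a n) * (r * r ^ n)" by simp
    also have "\<dots> \<le> a (Suc n) * (r * r ^ n)"
      using step[of n] \<open>0 < r\<close> by (intro mult_right_mono) auto
    finally show ?case by simp
  qed simp
  obtain n where "C / a 0 < (q * r) ^ n"
    using real_arch_pow[OF q(2)] by blast
  then have "C < (q * r) ^ n * a 0"
    using a0 by (simp add: field_simps)
  with grow[of n] bound[of n] show False by linarith
qed

section \<open>Resolvent estimates for normal operators\<close>

text \<open>
  Cauchy's inequality for \<open>w \<mapsto> \<langle>(T - w)\<^sup>-\<^sup>1 y, u\<rangle>\<close> on the circle of radius \<open>r < d\<close> about \<open>z\<close> bounds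
  \<open>\<parallel>K\<^sup>n y\<parallel> r\<^sup>n\<close>, where \<open>K = (T - z)\<^sup>-\<^sup>1\<close>. As \<open>K\<close> is paranormal, \<open>n \<mapsto> \<parallel>K\<^sup>n y\<parallel>\<close> is logarithmically convex,
  so the bound forces \<open>r \<parallel>K y\<parallel> \<le> \<parallel>y\<parallel>\<close>.
\<close>

lemma normal_op_norm_lower_bound:
  assumes H: "hilbert_subspace H" and lin: "linear_op H H T" and normal: "normal_op H T"
    and d: "0 < d" and ball: "ball z d \<subseteq> resolvent_set H T" and x: "x \<in> domain T"
  shows "d * norm x \<le> norm (app T x - z *\<^sub>C x)"
proof -
  define y where "y = app T x - z *\<^sub>C x"
  have z: "z \<in> resolvent_set H T"
    using ball d by (simp add: subset_iff)
  have yH: "y \<in> H"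
    using linear_opD(6,7)[OF lin x] hilbert_subspaceD[OF H] by (simp add: y_def)
  define K where "K n = (resolvent T z ^^ n) y" for n
  have K0: "K 0 = y" and KSuc: "K (Suc n) = resolvent T z (K n)" for n
    by (simp_all add: K_def)
  have K1: "K 1 = x"
    using resolvent_eqI[OF z x y_def[symmetric]] KSuc[of 0] K0 by simp
  have KH: "K n \<in> H" for n
  proof (induction n)
    case (Suc n)
    then show ?case
      using resolvent_setD(1)[OF z] linear_opD(6)[OF lin] by (simp add: KSuc)
  qed (simp add: K0 yH)
  have KD: "K (Suc n) \<in> domain T" "app T (K (Suc n)) - z *\<^sub>C K (Suc n) = K n" for n
    using resolvent_setD[OF z KH] by (simp_all add: KSuc)
  have *: "r * norm x \<le> norm y" if r: "0 < r" "r < d" for r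
  proof -
    have sub: "cball z r \<subseteq> resolvent_set H T"
      using ball r by (auto simp: subset_iff)
    have "compact ((\<lambda>w. resolvent T w y) ` cball z r)"
      using continuous_on_subset[OF continuous_on_resolvent[OF H lin yH] sub]
      by (intro compact_continuous_image) auto
    then obtain C where C: "\<And>w. w \<in> cball z r \<Longrightarrow> norm (resolvent T w y) \<le> C"
      using compact_imp_bounded[of "(\<lambda>w. resolvent T w y) ` cball z r"] unfolding bounded_iff by blast
    have C0: "0 \<le> C"
      using order_trans[OF norm_ge_zero C[of z]] r by simp
    have bound: "norm (K (Suc n)) * r ^ n \<le> C" for n
    proof -
      define u where "u = K (Suc n)"
      define F where "F k w = cinner (resolvent T w (K k)) u" for k w
      have hol: "F k holomorphic_on ball z d" for k
        unfolding F_def by (rule holomorphic_on_cinner_resolvent[OF H lin KH open_ball ball])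
      have expand: "F k w = F k z + (w - z) * F (Suc k) w" if "w \<in> ball z d" for k w
      proof -
        have w: "w \<in> resolvent_set H T"
          using that ball by blast
        have "resolvent T z (K k) = resolvent T w (K k) + (z - w) *\<^sub>C resolvent T w (K (Suc k))"
          using resolvent_identity(2)[OF H lin z w KH] by (simp add: KSuc)
        then have "F k z = F k w + (z - w) * F (Suc k) w"
          by (simp add: F_def cinner_add_left cinner_scaleC_left)
        then show ?thesis
          by (simp add: algebra_simps)
      qed
      have step: "(deriv ^^ Suc i) (F k) z = of_nat (Suc i) * (deriv ^^ i) (F (Suc k)) z" for i k
        by (rule higher_deriv_const_plus_mult[OF hol hol open_ball _ expand]) (simp_all add: d)
      have "(deriv ^^ i) (F k) z = fact i * F (k + i) z" for i k
      proof (induction i arbitrary: k)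
        case (Suc i)
        then show ?case
          unfolding step Suc.IH fact_Suc by (simp add: mult.assoc)
      qed simp
      from this[of n 0] have "(deriv ^^ n) (F 0) z = fact n * cinner u u"
        by (simp add: F_def u_def KSuc)
      then have "norm ((deriv ^^ n) (F 0) z) = fact n * (norm u)\<^sup>2"
        by (simp add: cinner_self norm_mult norm_power)
      moreover have "norm ((deriv ^^ n) (F 0) z) \<le> fact n * (C * norm u) / r ^ n"
      proof (rule Cauchy_inequality)
        show "F 0 holomorphic_on ball z r"
          using hol by (rule holomorphic_on_subset) (use r in auto)
        show "continuous_on (cball z r) (F 0)"
          using holomorphic_on_imp_continuous_on[OF hol] by (rule continuous_on_subset) (use r in auto)
        fix w assume "norm (z - w) = r"
        then have "norm (resolvent T w y) \<le> C"
          by (intro C) (simp add: dist_norm)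
        then have "norm (resolvent T w y) * norm u \<le> C * norm u"
          by (rule mult_right_mono) simp
        then show "norm (F 0 w) \<le> C * norm u"
          unfolding F_def K0 by (rule order_trans[OF cinner_Cauchy_Schwarz])
      qed (use r in auto)
      ultimately have "fact n * (norm u)\<^sup>2 \<le> fact n * (C * norm u / r ^ n)"
        by simp
      then have "(norm u)\<^sup>2 \<le> C * norm u / r ^ n"
        by (subst (asm) mult_le_cancel_left_pos) auto
      then have "norm u * r ^ n * norm u \<le> C * norm u"
        using r by (simp add: field_simps power2_eq_square)
      then show ?thesis
        using C0 by (cases "u = 0") (auto simp: u_def[symmetric] mult.commute)
    qed
    have "r * norm (K 1) \<le> norm (K 0)"
    proof (rule log_convex_first_ratio[where a = "\<lambda>n. norm (K n)" and C = "max (norm y) (C * r)"])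
      show "(norm (K (Suc n)))\<^sup>2 \<le> norm (K n) * norm (K (Suc (Suc n)))" for n
        using normal_op_paranormal[OF H lin normal KD(1)[of "Suc n"] KD(2)[of "Suc n"] KD(1)[of n]]
        by (simp add: KD(2) mult.commute)
      show "norm (K n) * r ^ n \<le> max (norm y) (C * r)" for n
      proof (cases n)
        case (Suc k)
        then show ?thesis
          using mult_right_mono[OF bound[of k], of r] r by (simp add: mult_ac le_max_iff_disj)
      qed (simp add: K0)
    qed (use r in auto)
    then show ?thesis
      unfolding K0 K1 .
  qed
  have "d * norm x \<le> norm y"
  proof (cases "x = 0")
    case False
    then have "r \<le> norm y / norm x" if "0 < r" "r < d" for r
      using *[OF that] by (simp add: pos_le_divide_eq)
    then have "d \<le> norm y / norm x"
      by (rule dense_le_bounded[OF d])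
    then show ?thesis
      using False by (simp add: field_simps)
  qed simp
  then show ?thesis
    by (simp add: y_def)
qed

text \<open>
  If a cone \<open>S\<close> has distance at least \<open>d\<close> from \<open>z\<close>, it has distance at least \<open>s d\<close> from \<open>s z\<close>, for all
  \<open>s > 0\<close>. The bound on \<open>\<parallel>T x\<parallel>\<close> is the operator version of \<open>\<bar>\<mu>\<bar> / \<bar>\<mu> - z\<bar> \<le> \<bar>z\<bar> / d\<close> for \<open>\<mu> \<in> S\<close>. This
  condition puts \<open>\<mu>\<close> outside a disc of Apollonius, whose centre is \<open>s z\<close> with
  \<open>s = \<bar>z\<bar>\<^sup>2 / (\<bar>z\<bar>\<^sup>2 - d\<^sup>2)\<close> and whose radius is \<open>s d\<close>; hence the lower bound for \<open>T - s z\<close> yields it. In the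
  degenerate case \<open>d = \<bar>z\<bar>\<close> the disc is a half-plane, reached as \<open>s \<rightarrow> \<infinity>\<close>.
\<close>

lemma normal_op_cone_bounds:
  assumes H: "hilbert_subspace H" and lin: "linear_op H H T" and normal: "normal_op H T"
    and spec: "spectrum H T \<subseteq> S"
    and cone: "\<And>s \<mu>. 0 < s \<Longrightarrow> \<mu> \<in> S \<Longrightarrow> complex_of_real s * \<mu> \<in> S" and "0 \<in> S"
    and d: "0 < d" "\<And>\<mu>. \<mu> \<in> S \<Longrightarrow> d \<le> norm (z - \<mu>)"
    and x: "x \<in> domain T"
  shows "z \<in> resolvent_set H T"
    and "d * norm x \<le> norm (app T x - z *\<^sub>C x)"
    and "d * norm (app T x) \<le> norm z * norm (app T x - z *\<^sub>C x)"
proof -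
  have scaled: "s * d * norm x \<le> norm (app T x - (complex_of_real s * z) *\<^sub>C x)" if s: "0 < s" for s
  proof (rule normal_op_norm_lower_bound[OF H lin normal _ _ x])
    show "0 < s * d"
      using s d(1) by simp
    show "ball (complex_of_real s * z) (s * d) \<subseteq> resolvent_set H T"
    proof
      fix w assume w: "w \<in> ball (complex_of_real s * z) (s * d)"
      show "w \<in> resolvent_set H T"
      proof (rule ccontr)
        assume "w \<notin> resolvent_set H T"
        then have "w \<in> S"
          using spec by (auto simp: spectrum_def)
        then have "d \<le> norm (z - complex_of_real (inverse s) * w)"
          using s by (intro d cone) auto
        then have "s * d \<le> norm (complex_of_real s) * norm (z - complex_of_real (inverse s) * w)"
          using s by simp
        also have "\<dots> = norm (complex_of_real s * z - w)"
        proof -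
          have eq: "complex_of_real s * (complex_of_real (inverse s) * w) = w"
            using s by (simp add: field_simps)
          show ?thesis
            unfolding norm_mult[symmetric] right_diff_distrib eq ..
        qed
        finally show False
          using w by (simp add: dist_norm)
      qed
    qed
  qed
  show "d * norm x \<le> norm (app T x - z *\<^sub>C x)"
    using scaled[of 1] by simp
  show "z \<in> resolvent_set H T"
    using d spec by (force simp: spectrum_def)
  define a \<beta> where "a = (norm (app T x))\<^sup>2" and "\<beta> = app T x \<bullet> (z *\<^sub>C x)"
  define k where "k = (norm z)\<^sup>2 - d\<^sup>2"
  have sq: "(norm (app T x - (complex_of_real s * z) *\<^sub>C x))\<^sup>2
      = a - 2 * s * \<beta> + s\<^sup>2 * ((norm z)\<^sup>2 * (norm x)\<^sup>2)" for s
    using power2_norm_diff_scaleR[of "app T x" s "z *\<^sub>C x"]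
    by (simp add: a_def \<beta>_def norm_scaleC power_mult_distrib power2_norm_eq_inner[symmetric]
        scaleC_of_real[symmetric] scaleC_scaleC)
  have ge: "0 \<le> a - 2 * s * \<beta> + s\<^sup>2 * (k * (norm x)\<^sup>2)" if "0 < s" for s
  proof -
    have "(s * d * norm x)\<^sup>2 \<le> (norm (app T x - (complex_of_real s * z) *\<^sub>C x))\<^sup>2"
      using scaled[OF that] that d(1) by (intro power_mono) auto
    then show ?thesis
      unfolding sq k_def by (simp add: power_mult_distrib algebra_simps)
  qed
  have "d \<le> norm z"
    using d(2)[OF \<open>0 \<in> S\<close>] by simp
  then have "0 \<le> k"
    using d(1) by (simp add: k_def power_mono)
  have "0 \<le> k * a - 2 * \<beta> * (norm z)\<^sup>2 + (norm z) ^ 4 * (norm x)\<^sup>2"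
  proof (cases "k = 0")
    case True
    have "\<beta> \<le> 0"
    proof (rule ccontr)
      assume "\<not> \<beta> \<le> 0"
      then show False
        using ge[of "(a + 1) / (2 * \<beta>)"] True by (simp add: a_def add_nonneg_pos)
    qed
    then have "\<beta> * (norm z)\<^sup>2 \<le> 0"
      by (simp add: mult_nonpos_nonneg)
    moreover have "0 \<le> (norm z) ^ 4 * (norm x)\<^sup>2"
      by simp
    ultimately show ?thesis
      unfolding True by linarith
  next
    case False
    with \<open>0 \<le> k\<close> have k: "0 < k" by simp
    have "0 < (norm z)\<^sup>2 / k"
      using k \<open>d \<le> norm z\<close> d(1) by (intro divide_pos_pos) auto
    from ge[OF this] have "0 \<le> k * (a - 2 * ((norm z)\<^sup>2 / k) * \<beta> + ((norm z)\<^sup>2 / k)\<^sup>2 * (k * (norm x)\<^sup>2))"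
      using k by simp
    also have "\<dots> = k * a - 2 * \<beta> * (norm z)\<^sup>2 + (norm z) ^ 4 * (norm x)\<^sup>2"
      using k by (simp add: field_simps power2_eq_square power4_eq_xxxx)
    finally show ?thesis .
  qed
  moreover have "(d * norm (app T x))\<^sup>2 \<le> (norm z * norm (app T x - z *\<^sub>C x))\<^sup>2"
    if "0 \<le> k * a - 2 * \<beta> * (norm z)\<^sup>2 + (norm z) ^ 4 * (norm x)\<^sup>2"
  proof -
    have "(norm (app T x - z *\<^sub>C x))\<^sup>2 = a - 2 * \<beta> + (norm z)\<^sup>2 * (norm x)\<^sup>2"
      using sq[of 1] by simp
    then have "(norm z * norm (app T x - z *\<^sub>C x))\<^sup>2
        = (norm z)\<^sup>2 * (a - 2 * \<beta> + (norm z)\<^sup>2 * (norm x)\<^sup>2)"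
      by (simp add: power_mult_distrib)
    also have "\<dots> = (norm z)\<^sup>2 * a - 2 * \<beta> * (norm z)\<^sup>2 + (norm z) ^ 4 * (norm x)\<^sup>2"
      by (simp add: power4_eq_xxxx power2_eq_square algebra_simps)
    finally show ?thesis
      using that by (simp add: k_def a_def power_mult_distrib left_diff_distrib)
  qed
  ultimately show "d * norm (app T x) \<le> norm z * norm (app T x - z *\<^sub>C x)"
    by (intro power2_le_imp_le[OF _ mult_nonneg_nonneg]) auto
qed

section \<open>Operator matrices\<close>

lemma norm_vec_le_sum: "norm (x :: 'a::real_normed_vector ^ 'n) \<le> (\<Sum>i\<in>UNIV. norm (x $ i))"
  by (simp add: norm_vec_def L2_set_le_sum)

lemma compact_vec_box:
  fixes C :: "'n::finite \<Rightarrow> 'a::metric_space set"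
  assumes "\<And>i. compact (C i)"
  shows "compact {x :: 'a ^ 'n. \<forall>i. x $ i \<in> C i}"
proof -
  have "compactin (product_topology (\<lambda>_. euclidean) UNIV) (PiE UNIV C)"
    unfolding compactin_PiE by (intro disjI2 ballI) (simp add: assms)
  then have "compact (PiE UNIV C)"
    by (simp only: euclidean_product_topology compactin_euclidean_iff)
  moreover have "continuous_on (PiE UNIV C) (\<lambda>f. \<chi> i. f i)"
    unfolding continuous_on_def
  proof (intro ballI tendsto_vec_lambda)
    fix f i
    have "continuous_on (PiE UNIV C) (\<lambda>f. f i)"
      by (rule continuous_on_subset[OF continuous_on_product_coordinates]) simp
    then show "((\<lambda>f. f i) \<longlongrightarrow> f i) (at f within PiE UNIV C)" if "f \<in> PiE UNIV C"
      using that unfolding continuous_on_def by blast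
  qed
  ultimately have "compact ((\<lambda>f. \<chi> i. f i) ` PiE UNIV C)"
    by (intro compact_continuous_image)
  also have "(\<lambda>f. \<chi> i. f i) ` PiE UNIV C = {x. \<forall>i. x $ i \<in> C i}"
  proof (intro equalityI subsetI)
    fix x assume "x \<in> {x. \<forall>i. x $ i \<in> C i}"
    then show "x \<in> (\<lambda>f. \<chi> i. f i) ` PiE UNIV C"
      by (intro image_eqI[of _ _ "\<lambda>i. x $ i"]) auto
  qed auto
  finally show ?thesis .
qed

text \<open>By the resolvent identity, compactness of one resolvent implies compactness of all.\<close>

lemma compact_map_resolvent:
  assumes H: "hilbert_subspace H" and lin: "linear_op H H T"
    and w: "w \<in> resolvent_set H T" and z: "z \<in> resolvent_set H T"
    and compact: "compact_map H (resolvent T z)"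
  shows "compact_map H (resolvent T w)"
  unfolding compact_map_def
proof (intro allI impI)
  fix B assume B: "B \<subseteq> H" "bounded B"
  define B' where "B' = (\<lambda>y. y + (w - z) *\<^sub>C resolvent T w y) ` B"
  obtain C where C: "0 < C" "\<And>y. y \<in> H \<Longrightarrow> norm (resolvent T w y) \<le> C * norm y"
    using resolvent_bound[OF w] by metis
  obtain b where b: "\<And>y. y \<in> B \<Longrightarrow> norm y \<le> b"
    using B(2) unfolding bounded_iff by blast
  have "norm (y + (w - z) *\<^sub>C resolvent T w y) \<le> b + norm (w - z) * (C * b)" if "y \<in> B" for y
  proof -
    have "norm (resolvent T w y) \<le> C * norm y"
      using C(2) B(1) that by blast
    also have "\<dots> \<le> C * b"
      using C(1) b[OF that] by simp
    finally have "norm ((w - z) *\<^sub>C resolvent T w y) \<le> norm (w - z) * (C * b)"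
      by (simp add: norm_scaleC mult_left_mono)
    then show ?thesis
      using b[OF that] norm_triangle_ineq[of y "(w - z) *\<^sub>C resolvent T w y"] by linarith
  qed
  then have "bounded B'"
    unfolding bounded_iff B'_def by blast
  moreover have "B' \<subseteq> H"
  proof
    fix u assume "u \<in> B'"
    then obtain y where y: "y \<in> B" and u: "u = y + (w - z) *\<^sub>C resolvent T w y"
      by (auto simp: B'_def)
    then have "y \<in> H"
      using B(1) by blast
    then have "resolvent T w y \<in> H"
      using resolvent_setD(1)[OF w] linear_opD(6)[OF lin] by blast
    with \<open>y \<in> H\<close> show "u \<in> H"
      unfolding u by (intro hilbert_subspaceD[OF H])
  qed
  ultimately have "compact (closure (resolvent T z ` B'))"
    using compact unfolding compact_map_def by blast
  moreover have "resolvent T w ` B \<subseteq> resolvent T z ` B'"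
    using resolvent_identity(1)[OF H lin w z] B(1) unfolding B'_def by fast
  then have "closure (resolvent T w ` B) \<subseteq> closure (resolvent T z ` B')"
    by (rule closure_mono)
  ultimately show "compact (closure (resolvent T w ` B))"
    by (metis closed_closure compact_Int_closed inf.absorb2)
qed

lemma hilbert_subspace_hilbert_sum:
  assumes "\<And>j. hilbert_subspace (H j)"
  shows "hilbert_subspace (hilbert_sum H)"
  unfolding hilbert_subspace_def complex_vector.subspace_def hilbert_sum_def
  using hilbert_subspaceD[OF assms] closed_vector_box[of H]
  by (simp add: scaleC_vec_def)

text \<open>
  With the diagonal part \<open>D\<close>, the off-diagonal part \<open>B\<close> and \<open>K = (D - z)\<^sup>-\<^sup>1\<close> one has
  \<open>M - z = (1 + B K) (D - z)\<close>. If the entries of \<open>B K\<close> are bounded by constants with sum \<open>q < 1\<close>, then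
  \<open>1 + B K\<close> is invertible by Banach's fixed point theorem, with inverse bounded by \<open>1 / (1 - q)\<close>.
\<close>

lemma op_matrix_resolvent:
  fixes A :: "'n::finite \<Rightarrow> 'n \<Rightarrow> ('a::complex_hilbert, 'a) unbounded_op"
  assumes H: "\<And>j. hilbert_subspace (H j)" and lin: "\<And>i j. linear_op (H j) (H i) (A i j)"
    and dom: "\<And>i j. domain (A j j) \<subseteq> domain (A i j)"
    and z: "\<And>j. z \<in> resolvent_set (H j) (A j j)"
    and c: "\<And>i j x. i \<noteq> j \<Longrightarrow> x \<in> domain (A j j) \<Longrightarrow>
      norm (app (A i j) x) \<le> c i j * norm (app (A j j) x - z *\<^sub>C x)"
    and c_nonneg: "\<And>i j. 0 \<le> c i j" and c_sum: "(\<Sum>i\<in>UNIV. \<Sum>j\<in>UNIV - {i}. c i j) < 1"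
  shows "z \<in> resolvent_set (hilbert_sum H) (op_matrix A)"
    and "(\<And>j. compact_map (H j) (resolvent (A j j) z)) \<Longrightarrow>
      compact_map (hilbert_sum H) (resolvent (op_matrix A) z)"
proof -
  let ?M = "op_matrix A"
  define q where "q = (\<Sum>i\<in>UNIV. \<Sum>j\<in>UNIV - {i}. c i j)"
  define K where "K W = (\<chi> j. resolvent (A j j) z (W $ j))" for W
  define B where "B U = (\<chi> i. \<Sum>j\<in>UNIV - {i}. app (A i j) (U $ j))" for U
  have "hilbert_subspace (hilbert_sum H)"
    by (rule hilbert_subspace_hilbert_sum[OF H])
  note sumH = hilbert_subspaceD[OF this]
  note HD = hilbert_subspaceD[OF H]
  have q: "0 \<le> q" "q < 1"
    using c_sum c_nonneg by (auto simp: q_def intro!: sum_nonneg)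
  have dom_M: "domain ?M = {U. \<forall>j. U $ j \<in> domain (A j j)}"
    using dom by (auto simp: op_matrix_def)
  have inH: "W $ j \<in> H j" if "W \<in> hilbert_sum H" for W j
    using that by (simp add: hilbert_sum_def)
  have K: "K W $ j \<in> domain (A j j)" "app (A j j) (K W $ j) - z *\<^sub>C K W $ j = W $ j"
    if "W \<in> hilbert_sum H" for W j
    using resolvent_setD[OF z inH[OF that]] by (simp_all add: K_def)
  have K_eqI: "K W = U"
    if "\<And>j. U $ j \<in> domain (A j j)" "\<And>j. app (A j j) (U $ j) - z *\<^sub>C U $ j = W $ j" for U W
    using resolvent_eqI[OF z that] by (simp add: K_def vec_eq_iff)
  have M: "app ?M U - z *\<^sub>C U = (\<chi> j. app (A j j) (U $ j) - z *\<^sub>C U $ j) + B U" for U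
    unfolding vec_eq_iff
  proof
    fix i
    have "(\<Sum>j\<in>UNIV. app (A i j) (U $ j)) = app (A i i) (U $ i) + (\<Sum>j\<in>UNIV - {i}. app (A i j) (U $ j))"
      by (rule sum.remove) auto
    then show "(app ?M U - z *\<^sub>C U) $ i = ((\<chi> j. app (A j j) (U $ j) - z *\<^sub>C U $ j) + B U) $ i"
      by (simp add: op_matrix_def B_def scaleC_vec_def)
  qed
  have B_H: "B U \<in> hilbert_sum H" if "\<And>j. U $ j \<in> domain (A j j)" for U
  proof -
    have "app (A i j) (U $ j) \<in> H i" for i j
      using that dom linear_opD(7)[OF lin] by blast
    then have "(\<Sum>j\<in>UNIV - {i}. app (A i j) (U $ j)) \<in> H i" for i
      using H[of i] unfolding hilbert_subspace_def by (intro complex_vector.subspace_sum) auto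
    then show ?thesis
      by (simp add: hilbert_sum_def B_def)
  qed
  have B_bound: "norm (B U) \<le> q * norm W"
    if U: "\<And>j. U $ j \<in> domain (A j j)" "\<And>j. app (A j j) (U $ j) - z *\<^sub>C U $ j = W $ j" for U W
  proof -
    have "norm (B U) \<le> (\<Sum>i\<in>UNIV. norm (B U $ i))"
      by (rule norm_vec_le_sum)
    also have "\<dots> \<le> (\<Sum>i\<in>UNIV. \<Sum>j\<in>UNIV - {i}. norm (app (A i j) (U $ j)))"
      unfolding B_def by (intro sum_mono) (simp add: norm_sum)
    also have "\<dots> \<le> (\<Sum>i\<in>UNIV. \<Sum>j\<in>UNIV - {i}. c i j * norm W)"
    proof (intro sum_mono)
      fix i j :: 'n assume "j \<in> UNIV - {i}"
      then have "norm (app (A i j) (U $ j)) \<le> c i j * norm (W $ j)"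
        using c[of i j "U $ j"] U by simp
      also have "\<dots> \<le> c i j * norm W"
        by (intro mult_left_mono Finite_Cartesian_Product.norm_nth_le c_nonneg)
      finally show "norm (app (A i j) (U $ j)) \<le> c i j * norm W" .
    qed
    also have "\<dots> = q * norm W"
      by (simp add: q_def sum_distrib_right)
    finally show ?thesis .
  qed
  have BK_diff: "norm (B (K W) - B (K W')) \<le> q * norm (W - W')"
    if W: "W \<in> hilbert_sum H" "W' \<in> hilbert_sum H" for W W'
  proof -
    have "K W $ j - K W' $ j \<in> domain (A j j)" for j
      using K(1) W linear_opD(4)[OF lin] by blast
    moreover have "app (A j j) (K W $ j - K W' $ j) - z *\<^sub>C (K W $ j - K W' $ j) = (W - W') $ j" for j
    proof -
      have "app (A j j) (K W $ j - K W' $ j) = app (A j j) (K W $ j) - app (A j j) (K W' $ j)"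
        by (rule linear_op_diff[OF lin K(1)[OF W(1)] K(1)[OF W(2)]])
      then have "app (A j j) (K W $ j - K W' $ j) - z *\<^sub>C (K W $ j - K W' $ j)
          = (app (A j j) (K W $ j) - z *\<^sub>C K W $ j) - (app (A j j) (K W' $ j) - z *\<^sub>C K W' $ j)"
        by (simp add: complex_vector.scale_right_diff_distrib)
      then show ?thesis
        unfolding K(2)[OF W(1)] K(2)[OF W(2)] by simp
    qed
    ultimately have "norm (B (K W - K W')) \<le> q * norm (W - W')"
      by (intro B_bound) simp_all
    moreover have "B (K W - K W') = B (K W) - B (K W')"
    proof -
      have "app (A i j) (K W $ j - K W' $ j) = app (A i j) (K W $ j) - app (A i j) (K W' $ j)" for i j
        using K(1)[OF W(1)] K(1)[OF W(2)] dom by (intro linear_op_diff[OF lin]) blast+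
      then show ?thesis
        by (simp add: B_def vec_eq_iff sum_subtractf)
    qed
    ultimately show ?thesis by simp
  qed
  \<comment> \<open>The solutions of \<open>(1 + B K) W = V\<close> are the fixed points of \<open>W \<mapsto> V - B K W\<close>.\<close>
  have fixpoint: "\<exists>!W\<in>hilbert_sum H. V - B (K W) = W" if V: "V \<in> hilbert_sum H" for V
  proof (rule Banach_fix[OF _ _ q])
    show "complete (hilbert_sum H)" "hilbert_sum H \<noteq> {}"
      using sumH(1,5) by (auto simp: complete_eq_closed)
    show "(\<lambda>W. V - B (K W)) ` hilbert_sum H \<subseteq> hilbert_sum H"
      using V sumH(3) B_H K(1) by blast
    show "dist (V - B (K W)) (V - B (K W')) \<le> q * dist W W'"
      if "W \<in> hilbert_sum H" "W' \<in> hilbert_sum H" for W W'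
      using BK_diff[OF that] by (simp add: dist_norm norm_minus_commute)
  qed
  have sol: "\<exists>W\<in>hilbert_sum H. K W \<in> domain ?M \<and> app ?M (K W) - z *\<^sub>C K W = V \<and>
      norm W \<le> norm V / (1 - q)" if V: "V \<in> hilbert_sum H" for V
  proof -
    obtain W where W: "W \<in> hilbert_sum H" and eq: "V - B (K W) = W"
      using fixpoint[OF V] by blast
    have "app ?M (K W) - z *\<^sub>C K W = W + B (K W)"
      unfolding M by (simp add: vec_eq_iff K(2)[OF W])
    then have MV: "app ?M (K W) - z *\<^sub>C K W = V"
      using eq by (simp add: diff_eq_eq)
    have "norm W \<le> norm V + norm (B (K W))"
      using norm_triangle_ineq4[of V "B (K W)"] eq by simp
    also have "norm (B (K W)) \<le> q * norm W"
      using K[OF W] by (rule B_bound)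
    finally have "norm W \<le> norm V / (1 - q)"
      using q by (simp add: field_simps)
    with W MV show ?thesis
      using K(1)[OF W] by (auto simp: dom_M)
  qed
  have inj: "inj_on (\<lambda>U. app ?M U - z *\<^sub>C U) (domain ?M)"
  proof (rule inj_onI)
    fix U U' assume U: "U \<in> domain ?M" "U' \<in> domain ?M"
      and eq: "app ?M U - z *\<^sub>C U = app ?M U' - z *\<^sub>C U'"
    define W where "W U = (\<chi> j. app (A j j) (U $ j) - z *\<^sub>C U $ j)" for U
    have WU: "W U \<in> hilbert_sum H" "K (W U) = U" if "U \<in> domain ?M" for U
    proof -
      show "K (W U) = U"
        using that by (intro K_eqI) (auto simp: W_def dom_M)
      have "app (A j j) (U $ j) - z *\<^sub>C U $ j \<in> H j" for j
        using that linear_opD(6,7)[OF lin[of j j], of "U $ j"] HD(3,4)[of _ j] by (auto simp: dom_M)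
      then show "W U \<in> hilbert_sum H"
        by (simp add: W_def hilbert_sum_def)
    qed
    define V where "V = app ?M U - z *\<^sub>C U"
    have "V = W U + B U" "V = W U' + B U'"
      using M eq by (simp_all add: V_def W_def)
    then have "V - B (K (W U)) = W U" "V - B (K (W U')) = W U'"
      using U WU(2) by (simp_all add: diff_eq_eq)
    moreover have "V \<in> hilbert_sum H"
      unfolding \<open>V = W U + B U\<close> using U WU(1) B_H by (intro sumH(2)) (auto simp: dom_M)
    ultimately have "W U = W U'"
      using fixpoint WU(1) U by blast
    then show "U = U'"
      using WU(2) U by metis
  qed
  have bij: "bij_betw (\<lambda>U. app ?M U - z *\<^sub>C U) (domain ?M) (hilbert_sum H)"
    unfolding bij_betw_def
  proof (intro conjI inj equalityI subsetI)
    fix V assume "V \<in> (\<lambda>U. app ?M U - z *\<^sub>C U) ` domain ?M"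
    then obtain U where U: "U \<in> domain ?M" and V: "V = app ?M U - z *\<^sub>C U" by blast
    have "app (A j j) (U $ j) - z *\<^sub>C U $ j \<in> H j" for j
      using U linear_opD(6,7)[OF lin[of j j], of "U $ j"] HD(3,4)[of _ j] by (auto simp: dom_M)
    then have "(\<chi> j. app (A j j) (U $ j) - z *\<^sub>C U $ j) \<in> hilbert_sum H"
      by (simp add: hilbert_sum_def)
    then show "V \<in> hilbert_sum H"
      unfolding V M using U B_H by (intro sumH(2)) (auto simp: dom_M)
  qed (use sol in blast)
  have resolvent_M: "\<exists>W\<in>hilbert_sum H. resolvent ?M z V = K W \<and> norm W \<le> norm V / (1 - q)"
    if V: "V \<in> hilbert_sum H" for V
  proof -
    obtain W where W: "W \<in> hilbert_sum H" "K W \<in> domain ?M" "app ?M (K W) - z *\<^sub>C K W = V"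
      "norm W \<le> norm V / (1 - q)"
      using sol[OF V] by blast
    have "resolvent ?M z V = K W"
      unfolding resolvent_def using inj W(2,3) by (intro inv_into_f_eq)
    with W show ?thesis by blast
  qed
  have "\<exists>C>0. \<forall>y\<in>H j. norm (resolvent (A j j) z y) \<le> C * norm y" for j
    using resolvent_bound[OF z] by metis
  then obtain C where C: "\<And>j. 0 < C j" "\<And>j y. y \<in> H j \<Longrightarrow> norm (resolvent (A j j) z y) \<le> C j * norm y"
    by metis
  have "norm (resolvent ?M z V) \<le> (\<Sum>j\<in>UNIV. C j) / (1 - q) * norm V" if V: "V \<in> hilbert_sum H" for V
  proof -
    obtain W where W: "W \<in> hilbert_sum H" and RV: "resolvent ?M z V = K W"
      and norm_W: "norm W \<le> norm V / (1 - q)"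
      using resolvent_M[OF V] by blast
    have "norm (K W) \<le> (\<Sum>j\<in>UNIV. norm (K W $ j))"
      by (rule norm_vec_le_sum)
    also have "\<dots> \<le> (\<Sum>j\<in>UNIV. C j * norm W)"
    proof (intro sum_mono)
      fix j
      have "norm (K W $ j) \<le> C j * norm (W $ j)"
        using C(2)[OF inH[OF W]] by (simp add: K_def)
      also have "\<dots> \<le> C j * norm W"
        using C(1)[of j] by (intro mult_left_mono Finite_Cartesian_Product.norm_nth_le) simp
      finally show "norm (K W $ j) \<le> C j * norm W" .
    qed
    also have "\<dots> = (\<Sum>j\<in>UNIV. C j) * norm W"
      by (simp add: sum_distrib_right)
    also have "\<dots> \<le> (\<Sum>j\<in>UNIV. C j) * (norm V / (1 - q))"
      using C(1) by (intro mult_left_mono norm_W sum_nonneg less_imp_le)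
    finally show ?thesis
      by (simp add: RV)
  qed
  with bij show "z \<in> resolvent_set (hilbert_sum H) ?M"
    unfolding resolvent_set_def by blast
  show "compact_map (hilbert_sum H) (resolvent ?M z)"
    if compact: "\<And>j. compact_map (H j) (resolvent (A j j) z)"
    unfolding compact_map_def
  proof (intro allI impI)
    fix S assume S: "S \<subseteq> hilbert_sum H" "bounded S"
    obtain r where r: "\<And>V. V \<in> S \<Longrightarrow> norm V \<le> r"
      using S(2) unfolding bounded_iff by blast
    define Q where "Q j = resolvent (A j j) z ` (H j \<inter> cball 0 (r / (1 - q)))" for j
    let ?X = "{U. \<forall>j. U $ j \<in> closure (Q j)}"
    have "compact (closure (Q j))" for j
      unfolding Q_def using compact[of j, unfolded compact_map_def]
      by (blast intro: bounded_subset[OF bounded_cball])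
    then have X: "compact ?X"
      by (rule compact_vec_box)
    have "resolvent ?M z ` S \<subseteq> ?X"
    proof
      fix U assume "U \<in> resolvent ?M z ` S"
      then obtain V where V: "V \<in> S" and U: "U = resolvent ?M z V" by blast
      then obtain W where W: "W \<in> hilbert_sum H" and RV: "resolvent ?M z V = K W"
        and norm_W: "norm W \<le> norm V / (1 - q)"
        using resolvent_M S(1) by blast
      have "norm (W $ j) \<le> r / (1 - q)" for j
        using order_trans[OF Finite_Cartesian_Product.norm_nth_le norm_W]
          divide_right_mono[OF r[OF V], of "1 - q"] q by (meson diff_ge_0_iff_ge less_imp_le order_trans)
      then have "K W $ j \<in> Q j" for j
        unfolding K_def Q_def vec_lambda_beta using inH[OF W] by (intro imageI) simp
      then show "U \<in> ?X"
        unfolding U RV by (simp add: set_mp[OF closure_subset])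
    qed
    then have "closure (resolvent ?M z ` S) \<subseteq> ?X"
      using X by (intro closure_minimal compact_imp_closed)
    then show "compact (closure (resolvent ?M z ` S))"
      using compact_Int_closed[OF X closed_closure[of "resolvent ?M z ` S"]] by (simp only: inf.absorb2)
  qed
qed

text \<open>
  For \<open>z\<close> at distance at least \<open>d\<close> from the cone, the estimates \<open>\<parallel>x\<parallel> \<le> r / d\<close> and
  \<open>\<parallel>T x\<parallel> \<le> \<bar>z\<bar> r / d\<close> with \<open>r = \<parallel>(T - z) x\<parallel>\<close> turn the \<open>k\<close>-th subordination term into
  \<open>b\<^sub>k \<bar>z\<bar>\<^sup>q r / d\<close>, where \<open>q = p\<^sub>k\<close>.
\<close>

lemma subordination_data_bound:
  assumes sub: "subordination_data S T N b p" and p: "\<And>k. k \<in> {1..N} \<Longrightarrow> p k < 1"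
    and x: "x \<in> domain T" and "0 < d" "0 < \<zeta>"
    and bounds: "d * norm x \<le> r" "d * norm (app T x) \<le> \<zeta> * r"
  shows "norm (app S x) \<le> (\<Sum>k=1..N. b k * (rpow \<zeta> (p k) / d)) * r"
proof -
  have "0 \<le> d * norm x"
    using \<open>0 < d\<close> by simp
  then have r: "0 \<le> r / d"
    using order_trans[OF _ bounds(1)] \<open>0 < d\<close> by simp
  have le: "norm x \<le> r / d" "norm (app T x) \<le> \<zeta> * (r / d)"
    using bounds \<open>0 < d\<close> by (simp_all add: field_simps)
  have "norm (app S x) \<le> (\<Sum>k=1..N. b k * rpow (norm (app T x)) (p k) * rpow (norm x) (1 - p k))"
    using sub x by (simp add: subordination_data_def)
  also have "\<dots> \<le> (\<Sum>k=1..N. b k * (rpow \<zeta> (p k) / d) * r)"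
  proof (intro sum_mono)
    fix k assume k: "k \<in> {1..N}"
    then have b: "0 \<le> b k" and p': "0 \<le> p k" "p k < 1"
      using sub p by (auto simp: subordination_data_def)
    have "rpow (norm (app T x)) (p k) * rpow (norm x) (1 - p k) \<le> rpow \<zeta> (p k) / d * r"
    proof (cases "p k = 0")
      case True
      then show ?thesis
        using le(1) by (simp add: rpow_def)
    next
      case False
      then have "rpow (norm (app T x)) (p k) * rpow (norm x) (1 - p k)
          = norm (app T x) powr p k * norm x powr (1 - p k)"
        using p' by (simp add: rpow_def)
      also have "\<dots> \<le> (\<zeta> * (r / d)) powr p k * (r / d) powr (1 - p k)"
        using p' le r by (intro mult_mono powr_mono2) auto
      also have "\<dots> = \<zeta> powr p k * ((r / d) powr p k * (r / d) powr (1 - p k))"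
        using r \<open>0 < \<zeta>\<close> by (simp only: powr_mult mult.assoc)
      also have "\<dots> = \<zeta> powr p k * (r / d)"
        unfolding powr_add[symmetric] using abs_of_nonneg[OF r] by (simp del: abs_divide)
      finally show ?thesis
        using False by (simp add: rpow_def)
    qed
    then have "b k * (rpow (norm (app T x)) (p k) * rpow (norm x) (1 - p k))
        \<le> b k * (rpow \<zeta> (p k) / d * r)"
      using b by (rule mult_left_mono)
    then show "b k * rpow (norm (app T x)) (p k) * rpow (norm x) (1 - p k)
        \<le> b k * (rpow \<zeta> (p k) / d) * r"
      by (simp only: mult.assoc)
  qed
  finally show ?thesis
    by (simp only: sum_distrib_right)
qed

lemma concat_index_Sigma: "concat_index N = (SIGMA i:UNIV. SIGMA j:UNIV - {i}. {1..N i j})"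
  by (auto simp: concat_index_def)

lemma sum_concat_index:
  fixes N :: "'n::finite \<Rightarrow> 'n \<Rightarrow> nat"
  shows "(\<Sum>(i, j, k)\<in>concat_index N. f i j k)
    = (\<Sum>i\<in>UNIV. \<Sum>j\<in>UNIV - {i}. \<Sum>k=1..N i j. f i j k)"
proof -
  have "(\<Sum>i\<in>UNIV. \<Sum>j\<in>UNIV - {i}. \<Sum>k=1..N i j. f i j k)
      = (\<Sum>i\<in>UNIV. \<Sum>(j, k)\<in>(SIGMA j:UNIV - {i}. {1..N i j}). f i j k)"
    by (intro sum.cong refl sum.Sigma) auto
  also have "\<dots> = (\<Sum>(i, j, k)\<in>concat_index N. f i j k)"
    unfolding concat_index_Sigma by (rule sum.Sigma) auto
  finally show ?thesis ..
qed

lemma finite_concat_index: "finite (concat_index (N :: 'n::finite \<Rightarrow> 'n \<Rightarrow> nat))"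
  unfolding concat_index_Sigma by (intro finite_SigmaI) auto

text \<open>
  If \<open>z\<close> has distance at least \<open>d\<close> from the cone containing the spectra, the entries of the
  perturbation are bounded by \<open>\<Sum> b\<^sub>k \<bar>z\<bar>\<^sup>q / d\<close> with \<open>q = p\<^sub>k\<close>; all these bounds together sum to at most
  \<open>(\<Sum> b\<^sub>k) / \<alpha> < 1\<close> as soon as \<open>\<alpha> \<bar>z\<bar>\<^sup>q \<le> d\<close> for all exponents.
\<close>

lemma op_matrix_resolvent_outside_cone:
  fixes A :: "'n::finite \<Rightarrow> 'n \<Rightarrow> ('a::complex_hilbert, 'a) unbounded_op"
  assumes H: "\<And>j. hilbert_subspace (H j)" and lin: "\<And>i j. linear_op (H j) (H i) (A i j)"
    and gen_sub: "diagonally_generalized_subordinate A"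
    and sub: "\<And>i j. i \<noteq> j \<Longrightarrow> subordination_data (A i j) (A j j) (N i j) (b i j) (p i j)"
    and p: "\<And>i j k. (i, j, k) \<in> concat_index N \<Longrightarrow> p i j k \<in> {0..<1}"
    and normal: "\<And>j. normal_op (H j) (A j j)"
    and compact: "\<And>j. has_compact_resolvent (H j) (A j j)"
    and spec: "\<And>j. spectrum (H j) (A j j) \<subseteq> S"
    and cone: "\<And>s \<mu>. 0 < s \<Longrightarrow> \<mu> \<in> S \<Longrightarrow> complex_of_real s * \<mu> \<in> S" and "0 \<in> S"
    and d: "0 < d" "\<And>\<mu>. \<mu> \<in> S \<Longrightarrow> d \<le> norm (z - \<mu>)"
    and \<alpha>: "(\<Sum>(i, j, k)\<in>concat_index N. b i j k) < \<alpha>"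
    and small: "\<And>q. q \<in> (\<lambda>(i, j, k). p i j k) ` concat_index N \<Longrightarrow> \<alpha> * rpow (norm z) q \<le> d"
  shows "z \<in> resolvent_set (hilbert_sum H) (op_matrix A)"
    and "compact_map (hilbert_sum H) (resolvent (op_matrix A) z)"
proof -
  define c where "c i j = (if i = j then 0 else \<Sum>k=1..N i j. b i j k * (rpow (norm z) (p i j k) / d))" for i j
  have zn: "0 < norm z"
    using d(1) d(2)[OF \<open>0 \<in> S\<close>] unfolding diff_0_right by linarith
  have b: "0 \<le> b i j k" if "(i, j, k) \<in> concat_index N" for i j k
    using that sub[of i j] by (auto simp: concat_index_def subordination_data_def)
  have "0 \<le> (\<Sum>(i, j, k)\<in>concat_index N. b i j k)"
    using b by (intro sum_nonneg) auto
  with \<alpha> have \<alpha>0: "0 < \<alpha>" by linarith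
  have rpow_nonneg: "0 \<le> rpow x q" for x q
    by (simp add: rpow_def)
  have dom: "domain (A j j) \<subseteq> domain (A i j)" for i j
    using gen_sub by (cases "i = j")
      (auto simp: diagonally_generalized_subordinate_def generalized_subordinate_def)
  have z: "z \<in> resolvent_set (H j) (A j j)" for j
    using d spec[of j] by (force simp: spectrum_def)
  have bound: "norm (app (A i j) x) \<le> c i j * norm (app (A j j) x - z *\<^sub>C x)"
    if ij: "i \<noteq> j" and x: "x \<in> domain (A j j)" for i j x
  proof -
    note cone_bounds = normal_op_cone_bounds[OF H lin normal spec cone \<open>0 \<in> S\<close> d x]
    have "norm (app (A i j) x) \<le> (\<Sum>k=1..N i j. b i j k * (rpow (norm z) (p i j k) / d))
        * norm (app (A j j) x - z *\<^sub>C x)"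
    proof (rule subordination_data_bound[OF sub[OF ij] _ x d(1) zn])
      show "p i j k < 1" if "k \<in> {1..N i j}" for k
        using p[of i j k] that ij by (simp add: concat_index_def)
    qed (rule cone_bounds; assumption)+
    then show ?thesis
      using ij by (simp add: c_def)
  qed
  have c_nonneg: "0 \<le> c i j" for i j
    using d(1) b[of i j] rpow_nonneg
    by (auto simp: c_def concat_index_def intro!: sum_nonneg mult_nonneg_nonneg)
  have "(\<Sum>i\<in>UNIV. \<Sum>j\<in>UNIV - {i}. c i j)
      = (\<Sum>i\<in>UNIV. \<Sum>j\<in>UNIV - {i}. \<Sum>k=1..N i j. b i j k * (rpow (norm z) (p i j k) / d))"
    by (intro sum.cong refl) (auto simp: c_def)
  also have "\<dots> = (\<Sum>(i, j, k)\<in>concat_index N. b i j k * (rpow (norm z) (p i j k) / d))"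
    by (rule sum_concat_index[symmetric])
  also have "\<dots> \<le> (\<Sum>(i, j, k)\<in>concat_index N. b i j k * (1 / \<alpha>))"
  proof (intro sum_mono)
    fix t assume t: "t \<in> concat_index N"
    obtain i j k where ijk: "t = (i, j, k)" by (cases t)
    have "p i j k \<in> (\<lambda>(i, j, k). p i j k) ` concat_index N"
      using t by (force simp: ijk)
    then have "\<alpha> * rpow (norm z) (p i j k) \<le> d"
      by (rule small)
    then have "rpow (norm z) (p i j k) / d \<le> 1 / \<alpha>"
      using \<alpha>0 d(1) by (simp add: field_simps)
    then have "b i j k * (rpow (norm z) (p i j k) / d) \<le> b i j k * (1 / \<alpha>)"
      using b[of i j k] t unfolding ijk by (intro mult_left_mono)
    then show "(case t of (i, j, k) \<Rightarrow> b i j k * (rpow (norm z) (p i j k) / d))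
        \<le> (case t of (i, j, k) \<Rightarrow> b i j k * (1 / \<alpha>))"
      unfolding ijk by simp
  qed
  also have "\<dots> = (\<Sum>(i, j, k)\<in>concat_index N. b i j k) / \<alpha>"
    by (simp add: sum_divide_distrib case_prod_unfold)
  also have "\<dots> < 1"
    using \<alpha> \<alpha>0 by simp
  finally have c_sum: "(\<Sum>i\<in>UNIV. \<Sum>j\<in>UNIV - {i}. c i j) < 1" .
  show "z \<in> resolvent_set (hilbert_sum H) (op_matrix A)"
    by (rule op_matrix_resolvent(1)[OF H lin dom z bound c_nonneg c_sum])
  have compact_z: "compact_map (H j) (resolvent (A j j) z)" for j
  proof -
    obtain w where "w \<in> resolvent_set (H j) (A j j)" "compact_map (H j) (resolvent (A j j) w)"
      using compact[of j] unfolding has_compact_resolvent_def by blast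
    then show ?thesis
      by (rule compact_map_resolvent[OF H lin z])
  qed
  show "compact_map (hilbert_sum H) (resolvent (op_matrix A) z)"
    by (rule op_matrix_resolvent(2)[OF H lin dom z bound c_nonneg c_sum compact_z])
qed

section \<open>Rays and their neighbourhoods\<close>

lemma mem_ray_iff: "z \<in> ray \<theta> \<longleftrightarrow> Im (cis (- \<theta>) * z) = 0 \<and> 0 \<le> Re (cis (- \<theta>) * z)"
proof
  assume "z \<in> ray \<theta>"
  then obtain x where x: "0 \<le> x" and z: "z = cis \<theta> * complex_of_real x"
    by (auto simp: ray_def)
  have "cis (- \<theta>) * z = complex_of_real x"
    unfolding z mult.assoc[symmetric] cis_mult by simp
  then show "Im (cis (- \<theta>) * z) = 0 \<and> 0 \<le> Re (cis (- \<theta>) * z)"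
    using x by (simp only: Im_complex_of_real Re_complex_of_real)
next
  define x where "x = Re (cis (- \<theta>) * z)"
  assume *: "Im (cis (- \<theta>) * z) = 0 \<and> 0 \<le> Re (cis (- \<theta>) * z)"
  then have "cis (- \<theta>) * z = complex_of_real x"
    unfolding x_def by (intro complex_eqI) simp_all
  then have "cis \<theta> * complex_of_real x = cis \<theta> * (cis (- \<theta>) * z)"
    by simp
  also have "\<dots> = z"
    unfolding mult.assoc[symmetric] cis_mult by simp
  finally show "z \<in> ray \<theta>"
    using * unfolding ray_def x_def[symmetric] by blast
qed

lemma closed_ray: "closed (ray \<theta>)"
proof -
  have "ray \<theta> = {z. Im (cis (- \<theta>) * z) = 0 \<and> 0 \<le> Re (cis (- \<theta>) * z)}"
    using mem_ray_iff by blast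
  also have "closed \<dots>"
    by (intro closed_Collect_conj closed_Collect_eq closed_Collect_le continuous_intros)
  finally show ?thesis .
qed

lemma zero_in_ray: "0 \<in> ray \<theta>"
  by (simp add: mem_ray_iff)

lemma scaled_in_ray:
  assumes "0 < s" and "\<mu> \<in> ray \<theta>"
  shows "complex_of_real s * \<mu> \<in> ray \<theta>"
proof -
  obtain x where "0 \<le> x" "\<mu> = cis \<theta> * complex_of_real x"
    using assms(2) by (auto simp: ray_def)
  then have "0 \<le> s * x" "complex_of_real s * \<mu> = cis \<theta> * complex_of_real (s * x)"
    using assms(1) by simp_all
  then show ?thesis
    unfolding ray_def by blast
qed

lemma ray_subset_power_region:
  assumes "finite P"
  shows "ray \<theta> \<subseteq> power_region \<alpha> P \<theta>"
proof
  fix z assume "z \<in> ray \<theta>"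
  then obtain x where "0 \<le> x" "z = cis \<theta> * Complex x 0"
    by (auto simp: ray_def complex_of_real_def)
  moreover have "\<bar>0\<bar> \<le> Max (insert 0 ((\<lambda>q. \<alpha> * rpow x q) ` P))"
    using assms by simp
  ultimately show "z \<in> power_region \<alpha> P \<theta>"
    unfolding power_region_def by blast
qed

lemma rpow_pos_eq: "0 < x \<Longrightarrow> rpow x q = x powr q"
  by (simp add: rpow_def)

lemma rpow_le_linear:
  assumes "finite P" and "P \<subseteq> {0..<1}" and "0 < \<alpha>" and "0 < \<kappa>"
  obtains r where "1 \<le> r" "\<And>q t. q \<in> P \<Longrightarrow> r \<le> t \<Longrightarrow> \<alpha> * rpow t q \<le> \<kappa> * t"
proof
  define f where "f q = (\<alpha> / \<kappa>) powr (1 / (1 - q))" for q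
  define r where "r = Max (insert 1 (f ` P))"
  show r1: "1 \<le> r"
    using assms(1) by (simp add: r_def)
  show "\<alpha> * rpow t q \<le> \<kappa> * t" if q: "q \<in> P" and t: "r \<le> t" for q t
  proof -
    have q1: "q < 1"
      using assms(2) q by auto
    have "f q \<le> r"
      using assms(1) q by (simp add: r_def)
    then have "f q powr (1 - q) \<le> t powr (1 - q)"
      using q1 t by (intro powr_mono2) (auto simp: f_def)
    then have "\<alpha> / \<kappa> \<le> t powr (1 - q)"
      using assms(3,4) q1 by (simp add: f_def powr_powr)
    then have "\<alpha> \<le> \<kappa> * t powr (1 - q)"
      using \<open>0 < \<kappa>\<close> by (simp add: field_simps)
    then have "\<alpha> * t powr q \<le> \<kappa> * t powr (1 - q) * t powr q"
      by (rule mult_right_mono) simp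
    also have "\<dots> = \<kappa> * t"
      using t r1 by (simp add: mult.assoc flip: powr_add)
    finally show ?thesis
      using t r1 by (simp add: rpow_pos_eq)
  qed
qed

text \<open>
  Write \<open>z = e\<^sup>i\<^sup>\<theta> (x + i y)\<close>. For \<open>x < 0\<close> the distance of \<open>z\<close> to the ray is \<open>\<bar>z\<bar>\<close>, and for \<open>\<bar>y\<bar> > \<epsilon> x \<ge> 0\<close> it is
  comparable to \<open>\<bar>z\<bar>\<close>; this dominates \<open>\<beta> \<bar>z\<bar>\<^sup>q\<close> for large \<open>z\<close> because \<open>q < 1\<close>. For \<open>\<bar>y\<bar> \<le> \<epsilon> x\<close> the distance
  \<open>\<bar>y\<bar>\<close> exceeds \<open>\<alpha> x\<^sup>q\<close>, while \<open>\<bar>z\<bar> \<le> (1 + \<epsilon>) x\<close>; the gap between \<open>\<beta>\<close> and \<open>\<alpha>\<close> absorbs the factor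
  \<open>1 + \<epsilon>\<close>.
\<close>

lemma dist_ray_outside_power_region:
  assumes P: "finite P" "P \<subseteq> {0..<1}" and \<beta>: "0 < \<beta>" "\<beta> < \<alpha>"
  obtains r where "1 \<le> r"
    "\<And>z \<theta> \<mu> q. r \<le> norm z \<Longrightarrow> z \<notin> power_region \<alpha> P \<theta> \<Longrightarrow> \<mu> \<in> ray \<theta> \<Longrightarrow> q \<in> P \<Longrightarrow>
      \<beta> * rpow (norm z) q \<le> norm (z - \<mu>)"
proof -
  define \<epsilon> where "\<epsilon> = \<alpha> / \<beta> - 1"
  have \<epsilon>: "0 < \<epsilon>" "\<beta> * (1 + \<epsilon>) = \<alpha>"
    using \<beta> by (simp_all add: \<epsilon>_def field_simps)
  define \<kappa> where "\<kappa> = \<epsilon> / (1 + \<epsilon>)"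
  have \<kappa>: "0 < \<kappa>" "\<kappa> \<le> 1"
    using \<epsilon>(1) by (simp_all add: \<kappa>_def)
  obtain r where r: "1 \<le> r" and lin: "\<And>q t. q \<in> P \<Longrightarrow> r \<le> t \<Longrightarrow> \<beta> * rpow t q \<le> \<kappa> * t"
    using rpow_le_linear[OF P \<beta>(1) \<kappa>(1)] by blast
  show thesis
  proof (rule that[OF r])
    fix z \<theta> \<mu> q
    assume z: "r \<le> norm z" and out: "z \<notin> power_region \<alpha> P \<theta>" and \<mu>: "\<mu> \<in> ray \<theta>" and q: "q \<in> P"
    define x y where "x = Re (cis (- \<theta>) * z)" and "y = Im (cis (- \<theta>) * z)"
    have xy: "Complex x y = cis (- \<theta>) * z"
      unfolding x_def y_def by (rule complex_surj)
    have z_eq: "z = cis \<theta> * Complex x y"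
      unfolding xy mult.assoc[symmetric] cis_mult by simp
    obtain t where t: "0 \<le> t" and \<mu>_eq: "\<mu> = cis \<theta> * complex_of_real t"
      using \<mu> by (auto simp: ray_def)
    have nz: "norm z = norm (Complex x y)"
      unfolding xy by (simp add: norm_mult)
    have "z - \<mu> = cis \<theta> * (Complex x y - complex_of_real t)"
      unfolding right_diff_distrib \<mu>_eq z_eq[symmetric] ..
    also have "Complex x y - complex_of_real t = Complex (x - t) y"
      by (simp add: complex_eq_iff)
    finally have dist: "norm (z - \<mu>) = norm (Complex (x - t) y)"
      by (simp add: norm_mult)
    show "\<beta> * rpow (norm z) q \<le> norm (z - \<mu>)"
    proof (cases "x < 0")
      case True
      have "x\<^sup>2 \<le> (x - t)\<^sup>2"
        using True t by (intro abs_le_square_iff[THEN iffD1]) simp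
      then have "norm z \<le> norm (z - \<mu>)"
        unfolding dist nz complex_norm by simp
      moreover have "\<kappa> * norm z \<le> 1 * norm z"
        using \<kappa>(2) by (rule mult_right_mono) simp
      ultimately show ?thesis
        using lin[OF q z] by linarith
    next
      case False
      have "\<not> \<bar>y\<bar> \<le> Max (insert 0 ((\<lambda>q. \<alpha> * rpow x q) ` P))"
        using out z_eq False unfolding power_region_def by (simp only: not_less) blast
      moreover have "\<alpha> * rpow x q \<le> Max (insert 0 ((\<lambda>q. \<alpha> * rpow x q) ` P))"
        using P(1) q by (intro Max_ge) auto
      ultimately have y: "\<alpha> * rpow x q < \<bar>y\<bar>" by linarith
      have dist_y: "\<bar>y\<bar> \<le> norm (z - \<mu>)"
        unfolding dist using abs_Im_le_cmod[of "Complex (x - t) y"] by simp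
      have z_le: "norm z \<le> x + \<bar>y\<bar>"
        unfolding nz using cmod_le[of "Complex x y"] False by simp
      show ?thesis
      proof (cases "\<bar>y\<bar> \<le> \<epsilon> * x")
        case True
        then have z_le': "norm z \<le> (1 + \<epsilon>) * x"
          using z_le by (simp add: algebra_simps)
        have q': "0 \<le> q" "q \<le> 1"
          using q P(2) by auto
        have x: "0 < x"
          using z_le' z r False by (cases "x = 0") auto
        have "norm z powr q \<le> ((1 + \<epsilon>) * x) powr q"
          using z_le' q' by (intro powr_mono2) auto
        also have "\<dots> = (1 + \<epsilon>) powr q * x powr q"
          using x \<epsilon>(1) by (simp add: powr_mult)
        also have "\<dots> \<le> (1 + \<epsilon>) * x powr q"
          using powr_mono[of q 1 "1 + \<epsilon>"] \<epsilon>(1) q' by (intro mult_right_mono) auto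
        finally have "\<beta> * norm z powr q \<le> \<beta> * ((1 + \<epsilon>) * x powr q)"
          using \<beta>(1) by simp
        also have "\<dots> = \<alpha> * rpow x q"
          unfolding mult.assoc[symmetric] \<epsilon>(2) using x by (simp add: rpow_pos_eq)
        finally have "\<beta> * norm z powr q \<le> norm (z - \<mu>)"
          using y dist_y by linarith
        moreover have "0 < norm z"
          using z r by linarith
        ultimately show ?thesis
          by (simp add: rpow_pos_eq)
      next
        case False
        then have "\<epsilon> * (x + \<bar>y\<bar>) \<le> (1 + \<epsilon>) * \<bar>y\<bar>"
          by (simp add: algebra_simps)
        then have "\<epsilon> * norm z \<le> (1 + \<epsilon>) * \<bar>y\<bar>"
          using mult_left_mono[OF z_le, of \<epsilon>] \<epsilon>(1) by linarith
        then have "\<kappa> * norm z \<le> \<bar>y\<bar>"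
          using \<epsilon>(1) by (simp add: \<kappa>_def field_simps)
        then show ?thesis
          using lin[OF q z] dist_y by linarith
      qed
    qed
  qed
qed

lemma unit_vector_off_rays:
  assumes "finite L"
  obtains w where "norm w = 1" "w \<notin> (\<Union>l\<in>L. ray (\<theta> l))"
proof -
  have "infinite (sphere (0::complex) 1)"
  proof
    have "connected (sphere (0::complex) 1)"
      by (rule connected_sphere) simp
    moreover assume "finite (sphere (0::complex) 1)"
    ultimately have "sphere (0::complex) 1 = {} \<or> (\<exists>a. sphere (0::complex) 1 = {a})"
      using connected_finite_iff_sing by blast
    moreover have "1 \<in> sphere (0::complex) 1" "-1 \<in> sphere (0::complex) 1"
      by simp_all
    ultimately show False
      by (metis empty_iff one_neq_neg_one singletonD)
  qed
  then have "\<not> sphere 0 1 \<subseteq> (\<lambda>l. cis (\<theta> l)) ` L"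
    using assms finite_subset by blast
  then obtain w where "w \<in> sphere 0 1" and w_notin: "w \<notin> (\<lambda>l. cis (\<theta> l)) ` L"
    by blast
  then have w: "norm w = 1"
    by simp
  have "w \<notin> ray (\<theta> l)" if l: "l \<in> L" for l
  proof
    assume "w \<in> ray (\<theta> l)"
    then obtain x where x: "0 \<le> x" "w = cis (\<theta> l) * complex_of_real x"
      by (auto simp: ray_def)
    then have "x = 1"
      using w by (simp add: norm_mult)
    then show False
      using x w_notin l by simp
  qed
  with w show thesis
    by (intro that) auto
qed

section \<open>Spectral enclosure\<close>

theorem theorem2p1:
  fixes H :: "'n::finite \<Rightarrow> 'a::complex_hilbert set"
    and A :: "'n \<Rightarrow> 'n \<Rightarrow> ('a, 'a) unbounded_op"
    and N :: "'n \<Rightarrow> 'n \<Rightarrow> nat"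
    and b p :: "'n \<Rightarrow> 'n \<Rightarrow> nat \<Rightarrow> real"
    and mj :: "'n \<Rightarrow> nat"
    and \<theta>j :: "'n \<Rightarrow> nat \<Rightarrow> real"
    and m :: nat
    and \<theta> :: "nat \<Rightarrow> real"
  assumes "\<And>j. hilbert_subspace (H j)"
    and "\<And>i j. linear_op (H j) (H i) (A i j)"
    and "diagonally_generalized_subordinate A"
    and "\<And>i j. i \<noteq> j \<Longrightarrow> subordination_data (A i j) (A j j) (N i j) (b i j) (p i j)"
    and "\<And>i j k. (i, j, k) \<in> concat_index N \<Longrightarrow> p i j k \<in> {0..<1}"
    and "\<And>j. normal_op (H j) (A j j)"
    and "\<And>j. has_compact_resolvent (H j) (A j j)"
    and "\<And>j. spectrum (H j) (A j j) \<subseteq> (\<Union>l\<in>{1..mj j}. ray (\<theta>j j l))"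
    and "\<And>j l. l \<in> {1..mj j} \<Longrightarrow> 0 \<le> \<theta>j j l \<and> \<theta>j j l \<le> 2 * pi"
    and "1 \<le> m"
    and "\<theta> ` {1..m} = {\<theta>j j l | j l. l \<in> {1..mj j}}"
  shows "has_compact_resolvent (hilbert_sum H) (op_matrix A) \<and>
    (\<forall>\<alpha>. \<alpha> > (\<Sum>(i, j, k)\<in>concat_index N. b i j k) \<longrightarrow>
      (\<exists>r0>0. spectrum (hilbert_sum H) (op_matrix A) \<subseteq>
        ball 0 r0 \<union>
        (\<Union>l\<in>{1..m}. power_region \<alpha> ((\<lambda>(i, j, k). p i j k) ` concat_index N) (\<theta> l))))"
proof (intro conjI allI impI)
  define S where "S = (\<Union>l\<in>{1..m}. ray (\<theta> l))"
  define P where "P = (\<lambda>(i, j, k). p i j k) ` concat_index N"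
  define \<sigma> where "\<sigma> = (\<Sum>(i, j, k)\<in>concat_index N. b i j k)"
  have P: "finite P"
    unfolding P_def by (intro finite_imageI finite_concat_index)
  have P01: "P \<subseteq> {0..<1}"
    unfolding P_def using assms(5) by (intro image_subsetI) auto
  have spec: "spectrum (H j) (A j j) \<subseteq> S" for j
  proof
    fix \<mu> assume "\<mu> \<in> spectrum (H j) (A j j)"
    then obtain l where l: "l \<in> {1..mj j}" and \<mu>: "\<mu> \<in> ray (\<theta>j j l)"
      using assms(8) by blast
    then have "\<theta>j j l \<in> \<theta> ` {1..m}"
      unfolding assms(11) by blast
    then obtain l' where "l' \<in> {1..m}" "\<theta>j j l = \<theta> l'"
      by blast
    with \<mu> show "\<mu> \<in> S"
      unfolding S_def by auto
  qed
  have cone: "complex_of_real s * \<mu> \<in> S" if "0 < s" "\<mu> \<in> S" for s \<mu>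
    using that scaled_in_ray unfolding S_def by blast
  have S0: "0 \<in> S"
    unfolding S_def using assms(10) by (intro UN_I[of 1]) (simp_all add: zero_in_ray)
  have S_closed: "closed S"
    unfolding S_def by (intro closed_UN ballI closed_ray) simp
  have infdist_pos: "0 < infdist w S" if "w \<notin> S" for w
    using that S_closed S0 infdist_nonneg[of w S] in_closed_iff_infdist_zero[of S w] by force
  have infdist_norm: "infdist w S \<le> norm (w - \<mu>)" if "\<mu> \<in> S" for w \<mu>
    using infdist_le[OF that, of w] by (simp add: dist_norm)
  have \<sigma>0: "0 \<le> \<sigma>"
    unfolding \<sigma>_def using assms(4)
    by (intro sum_nonneg) (auto simp: concat_index_def subordination_data_def)
  have resolvent: "z \<in> resolvent_set (hilbert_sum H) (op_matrix A)"
    "compact_map (hilbert_sum H) (resolvent (op_matrix A) z)"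
    if "0 < d" "\<And>\<mu>. \<mu> \<in> S \<Longrightarrow> d \<le> norm (z - \<mu>)" "\<sigma> < \<beta>"
      "\<And>q. q \<in> P \<Longrightarrow> \<beta> * rpow (norm z) q \<le> d" for z d \<beta>
    by (rule op_matrix_resolvent_outside_cone[OF assms(1-7) spec cone S0
          that[unfolded P_def \<sigma>_def]]; assumption)+
  show "has_compact_resolvent (hilbert_sum H) (op_matrix A)"
  proof -
    \<comment> \<open>Along a direction off the rays the distance to \<open>S\<close> grows linearly.\<close>
    obtain w where w: "norm w = 1" "w \<notin> S"
      using unit_vector_off_rays[of "{1..m}" \<theta>] unfolding S_def by auto
    define \<delta> where "\<delta> = infdist w S"
    have \<delta>: "0 < \<delta>"
      unfolding \<delta>_def using w(2) by (rule infdist_pos)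
    have "0 < \<sigma> + 1"
      using \<sigma>0 by simp
    then obtain r where r: "1 \<le> r" "\<And>q t. q \<in> P \<Longrightarrow> r \<le> t \<Longrightarrow> (\<sigma> + 1) * rpow t q \<le> \<delta> * t"
      using rpow_le_linear[OF P P01 _ \<delta>] by blast
    define z where "z = complex_of_real r * w"
    have z: "\<delta> * r \<le> norm (z - \<mu>)" if "\<mu> \<in> S" for \<mu>
    proof -
      define \<nu> where "\<nu> = complex_of_real (inverse r) * \<mu>"
      have \<mu>: "\<mu> = complex_of_real r * \<nu>"
        using r(1) by (simp add: \<nu>_def)
      have "\<nu> \<in> S"
        unfolding \<nu>_def using r(1) that by (intro cone) auto
      then have "\<delta> * r \<le> norm (w - \<nu>) * r"
        using r(1) infdist_norm unfolding \<delta>_def by (intro mult_right_mono) auto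
      also have "\<dots> = norm (z - \<mu>)"
        unfolding z_def \<mu> right_diff_distrib[symmetric] norm_mult using r(1) by simp
      finally show ?thesis .
    qed
    have small: "(\<sigma> + 1) * rpow (norm z) q \<le> \<delta> * r" if "q \<in> P" for q
      using r(2)[OF that order_refl] r(1) w(1) by (simp add: z_def norm_mult)
    have pos: "0 < \<delta> * r" "\<sigma> < \<sigma> + 1"
      using \<delta> r(1) by simp_all
    show ?thesis
      unfolding has_compact_resolvent_def
      using resolvent[OF pos(1) z pos(2) small] by blast
  qed
  fix \<alpha> assume "(\<Sum>(i, j, k)\<in>concat_index N. b i j k) < \<alpha>"
  then have "\<sigma> < \<alpha>"
    by (simp add: \<sigma>_def)
  \<comment> \<open>A constant strictly between the sum of the \<open>b\<^sub>k\<close> and \<open>\<alpha>\<close>: the first gap makes the perturbation a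
    contraction, the second absorbs the difference between \<open>\<bar>z\<bar>\<close> and its component along the ray.\<close>
  define \<beta> where "\<beta> = (\<sigma> + \<alpha>) / 2"
  have \<beta>: "\<sigma> < \<beta>" "\<beta> < \<alpha>" "0 < \<beta>"
    using \<open>\<sigma> < \<alpha>\<close> \<sigma>0 by (simp_all add: \<beta>_def)
  obtain r where r: "1 \<le> r" and far: "\<And>z \<theta> \<mu> q. r \<le> norm z \<Longrightarrow> z \<notin> power_region \<alpha> P \<theta> \<Longrightarrow>
      \<mu> \<in> ray \<theta> \<Longrightarrow> q \<in> P \<Longrightarrow> \<beta> * rpow (norm z) q \<le> norm (z - \<mu>)"
    using dist_ray_outside_power_region[OF P P01 \<beta>(3,2)] by blast
  have far_resolvent: "z \<in> resolvent_set (hilbert_sum H) (op_matrix A)"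
    if z: "r \<le> norm z" and out: "\<And>l. l \<in> {1..m} \<Longrightarrow> z \<notin> power_region \<alpha> P (\<theta> l)" for z
  proof -
    have "z \<notin> S"
      using out ray_subset_power_region[OF P] unfolding S_def by blast
    then have pos: "0 < infdist z S"
      by (rule infdist_pos)
    have small: "\<beta> * rpow (norm z) q \<le> infdist z S" if q: "q \<in> P" for q
    proof -
      have "\<beta> * rpow (norm z) q \<le> dist z \<mu>" if \<mu>: "\<mu> \<in> S" for \<mu>
      proof -
        obtain l where "l \<in> {1..m}" "\<mu> \<in> ray (\<theta> l)"
          using \<mu> unfolding S_def by blast
        then show ?thesis
          unfolding dist_norm using far[OF z out _ q] by blast
      qed
      moreover have "S \<noteq> {}"
        using S0 by blast
      ultimately show ?thesis
        unfolding infdist_def by (auto intro!: cINF_greatest)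
    qed
    show ?thesis
      by (rule resolvent(1)[OF pos infdist_norm \<beta>(1) small])
  qed
  have "spectrum (hilbert_sum H) (op_matrix A) \<subseteq>
      ball 0 r \<union> (\<Union>l\<in>{1..m}. power_region \<alpha> P (\<theta> l))"
  proof
    fix z assume "z \<in> spectrum (hilbert_sum H) (op_matrix A)"
    then have "norm z < r \<or> (\<exists>l\<in>{1..m}. z \<in> power_region \<alpha> P (\<theta> l))"
      using far_resolvent[of z] unfolding spectrum_def not_less[symmetric] by blast
    then show "z \<in> ball 0 r \<union> (\<Union>l\<in>{1..m}. power_region \<alpha> P (\<theta> l))"
      by auto
  qed
  moreover have "0 < r"
    using r by linarith
  ultimately show "\<exists>r0>0. spectrum (hilbert_sum H) (op_matrix A) \<subseteq>
      ball 0 r0 \<union> (\<Union>l\<in>{1..m}. power_region \<alpha> ((\<lambda>(i, j, k). p i j k) ` concat_index N) (\<theta> l))"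
    unfolding P_def by blast
qed

end
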